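(* Let $n>1$ be an integer and let $t$ be the number of primes less than $\sqrt{n/2}$. Then every isolation of $I_n$ represents the lattice $I_{n-1}\perp D_n\perp A_{n-1}\perp\dots\perp A_{n-1}$, with $t-1$ copies of $A_{n-1}$. In particular, $2n-1+(n-1)(t-1)\le \mathrm{Iso}(I_n)$, and hence $\mathrm{Iso}(I_n)\in\Omega(n^{3/2-\epsilon})$ for every $\epsilon>0$.
   Context: All $\mathbb{Z}$-lattices are positive definite with integral Gram matrix. $M$ is represented by $L$ if there is a linear map $\sigma:M\to L$ with $Q(\sigma(x))=Q(x)$. $I_n=\langle 1,\dots,1\rangle$ is the cubic lattice (sum of $n$ squares); $\perp$ is orthogonal sum. $A_{n-1}=\{(a_1,\dots,a_n)\in\mathbb{Z}^n:\sum a_i=0\}$ and $D_n=\{(a_1,\dots,a_n)\in\mathbb{Z}^n:\sum a_i\equiv 0\pmod 2\}$ (with the standard inner product). A lattice $L$ is an isolation of $\ell$ if $L$ represents every sublattice of $\ell$ except $\ell$ itself, and does not represent $\ell$; $\mathrm{Iso}(\ell)$ is the minimum rank of an isolation of $\ell$. For arithmetic functions, $f(n)\in\Omega(g(n))$ means there is $C>0$ with $C g(n)\le f(n)$ for all sufficiently large $n$. *)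

theory Defs
  imports
    Complex_Main
    "HOL-Library.Function_Algebras"
    "HOL-Library.Product_Plus"
    "HOL-Library.Extended_Real"
    "HOL-Computational_Algebra.Primes"
begin

text \<open>The integer multiple \<open>k x\<close> in an arbitrary abelian group. It makes the group a module over
  the integers and so gives access to the library notions of span, dependence and submodule.\<close>

definition zmul :: "int \<Rightarrow> 'a::ab_group_add \<Rightarrow> 'a" where
  "zmul k x = (if 0 \<le> k then ((+) x ^^ nat k) 0 else - ((+) x ^^ nat (- k)) 0)"

lemma zmul_0 [simp]: "zmul 0 x = 0"
  by (simp add: zmul_def)

lemma zmul_succ: "zmul (k + 1) x = x + zmul k x"
proof -
  consider "0 \<le> k" | "k = - 1" | "k < - 1" by linarith
  then show ?thesis
  proof cases
    case 1
    then have "nat (k + 1) = Suc (nat k)" by simp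
    with 1 show ?thesis by (simp add: zmul_def)
  next
    case 2
    then show ?thesis by (simp add: zmul_def)
  next
    case 3
    then have "nat (- k) = Suc (nat (- (k + 1)))" by simp
    with 3 show ?thesis by (simp add: zmul_def)
  qed
qed

lemma zmul_1: "zmul 1 x = x"
  using zmul_succ[of 0 x] by simp

lemma zmul_pred: "zmul (k - 1) x = zmul k x - x"
  using zmul_succ[of "k - 1" x] by simp

lemma zmul_add_left: "zmul (a + b) x = zmul a x + zmul b x"
proof (induction a rule: int_induct[where k = 0])
  case (step1 i)
  have "i + 1 + b = (i + b) + 1" by simp
  then show ?case using step1 by (simp only: zmul_succ) (simp add: algebra_simps)
next
  case (step2 i)
  have "i - 1 + b = (i + b) - 1" by simp
  then show ?case using step2 by (simp only: zmul_pred) (simp add: algebra_simps)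
qed simp

lemma zmul_add_right: "zmul a (x + y) = zmul a x + zmul a y"
  by (induction a rule: int_induct[where k = 0])
     (simp_all add: zmul_succ zmul_pred algebra_simps)

lemma zmul_minus_left: "zmul (- a) x = - zmul a x"
  using zmul_add_left[of a "- a" x] by (simp add: eq_neg_iff_add_eq_0 add.commute)

lemma zmul_zmul: "zmul a (zmul b x) = zmul (a * b) x"
proof (induction a rule: int_induct[where k = 0])
  case (step1 i)
  have "(i + 1) * b = b + i * b" by (simp add: algebra_simps)
  then show ?case using step1 by (simp add: zmul_add_left zmul_1 add.commute)
next
  case (step2 i)
  have "(i - 1) * b = i * b + - b" by (simp add: algebra_simps)
  then show ?case using step2 by (simp only: zmul_pred zmul_add_left zmul_minus_left) simp
qed simp

interpretation zmod: module "zmul :: int \<Rightarrow> 'a::ab_group_add \<Rightarrow> 'a"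
  by unfold_locales (simp_all add: zmul_add_left zmul_add_right zmul_zmul zmul_1)

text \<open>A positive definite integral lattice, given by its set of vectors and its bilinear form
  \<open>B\<close>, with quadratic form \<open>x \<mapsto> B(x, x)\<close>. Only the values of the form on the carrier
  matter; taking them in \<open>int\<close> makes every Gram matrix integral.\<close>

record 'a zlat =
  lvecs :: "'a set"
  lform :: "'a \<Rightarrow> 'a \<Rightarrow> int"

definition zbasis :: "'a::ab_group_add zlat \<Rightarrow> 'a set \<Rightarrow> bool" where
  "zbasis L X \<longleftrightarrow> finite X \<and> \<not> zmod.dependent X \<and> zmod.span X = lvecs L"

definition zlattice :: "'a::ab_group_add zlat \<Rightarrow> bool" where
  "zlattice L \<longleftrightarrow>
     (\<exists>X. zbasis L X) \<and>
     (\<forall>x\<in>lvecs L. \<forall>y\<in>lvecs L. lform L x y = lform L y x) \<and>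
     (\<forall>x\<in>lvecs L. \<forall>y\<in>lvecs L. \<forall>z\<in>lvecs L. lform L (x + y) z = lform L x z + lform L y z) \<and>
     (\<forall>x\<in>lvecs L. x \<noteq> 0 \<longrightarrow> 0 < lform L x x)"

definition lrank :: "'a::ab_group_add zlat \<Rightarrow> nat" where
  "lrank L = card (SOME X. zbasis L X)"

definition lquad :: "'a zlat \<Rightarrow> 'a \<Rightarrow> int" where
  "lquad L x = lform L x x"

definition represents :: "'b::ab_group_add zlat \<Rightarrow> 'a::ab_group_add zlat \<Rightarrow> bool" where
  "represents L M \<longleftrightarrow>
     (\<exists>\<sigma>. (\<forall>x\<in>lvecs M. \<sigma> x \<in> lvecs L) \<and>
          (\<forall>x\<in>lvecs M. \<forall>y\<in>lvecs M. \<sigma> (x + y) = \<sigma> x + \<sigma> y) \<and>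
          (\<forall>x\<in>lvecs M. lquad L (\<sigma> x) = lquad M x))"

text \<open>Sublattices of any rank are allowed. A subgroup of a finitely generated free abelian group
  is again free, so every subgroup is a lattice under the restricted form.\<close>

definition sublattice :: "'a::ab_group_add zlat \<Rightarrow> 'a zlat \<Rightarrow> bool" where
  "sublattice N M \<longleftrightarrow>
     zmod.subspace (lvecs N) \<and> lvecs N \<subseteq> lvecs M \<and>
     (\<forall>x\<in>lvecs N. \<forall>y\<in>lvecs N. lform N x y = lform M x y)"

definition isolation :: "'b::ab_group_add zlat \<Rightarrow> 'a::ab_group_add zlat \<Rightarrow> bool" where
  "isolation L M \<longleftrightarrow>
     zlattice L \<and>
     (\<forall>N. sublattice N M \<and> lvecs N \<noteq> lvecs M \<longrightarrow> represents L N) \<and>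
     \<not> represents L M"

text \<open>The minimum is taken over lattices in the group \<open>nat \<Rightarrow> int\<close>, which contains an isometric
  copy of every lattice since it contains free abelian groups of every finite rank. Over
  \<open>enat\<close> the infimum of a nonempty set is its minimum, and it is infinite
  if there is no isolation.\<close>

definition Iso :: "'a::ab_group_add zlat \<Rightarrow> enat" where
  "Iso M = (INF L \<in> {L :: (nat \<Rightarrow> int) zlat. isolation L M}. enat (lrank L))"

text \<open>The group of integer vectors of length \<open>n\<close>, with coordinates indexed by \<open>0, ..., n - 1\<close>.\<close>

definition int_vecs :: "nat \<Rightarrow> (nat \<Rightarrow> int) set" where
  "int_vecs n = {x. \<forall>i\<ge>n. x i = 0}"

definition dot :: "nat \<Rightarrow> (nat \<Rightarrow> int) \<Rightarrow> (nat \<Rightarrow> int) \<Rightarrow> int" where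
  "dot n x y = (\<Sum>i<n. x i * y i)"

definition cubic_lattice :: "nat \<Rightarrow> (nat \<Rightarrow> int) zlat" where
  "cubic_lattice n = \<lparr>lvecs = int_vecs n, lform = dot n\<rparr>"

definition A_lattice :: "nat \<Rightarrow> (nat \<Rightarrow> int) zlat" where
  "A_lattice m = \<lparr>lvecs = {a \<in> int_vecs (Suc m). (\<Sum>i<Suc m. a i) = 0}, lform = dot (Suc m)\<rparr>"

definition D_lattice :: "nat \<Rightarrow> (nat \<Rightarrow> int) zlat" where
  "D_lattice n = \<lparr>lvecs = {a \<in> int_vecs n. even (\<Sum>i<n. a i)}, lform = dot n\<rparr>"

definition orth_sum :: "'a zlat \<Rightarrow> 'b zlat \<Rightarrow> ('a \<times> 'b) zlat"  (infixr "\<bottom>\<^sub>L" 65) where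
  "L \<bottom>\<^sub>L M =
     \<lparr>lvecs = lvecs L \<times> lvecs M,
      lform = (\<lambda>(x, x') (y, y'). lform L x y + lform M x' y')\<rparr>"

text \<open>The orthogonal sum of \<open>k\<close> copies of \<open>L\<close>; the zero lattice for \<open>k = 0\<close>.\<close>

definition orth_power :: "nat \<Rightarrow> 'a::zero zlat \<Rightarrow> (nat \<Rightarrow> 'a) zlat" where
  "orth_power k L =
     \<lparr>lvecs = {f. (\<forall>i<k. f i \<in> lvecs L) \<and> (\<forall>i\<ge>k. f i = 0)},
      lform = (\<lambda>f g. \<Sum>i<k. lform L (f i) (g i))\<rparr>"

definition num_primes :: "nat \<Rightarrow> nat" where
  "num_primes n = card {p::nat. prime p \<and> real p < sqrt (real n / 2)}"

text \<open>Lower bounds up to a positive constant, for functions that may take the value infinity.\<close>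

definition in_Omega :: "(nat \<Rightarrow> enat) \<Rightarrow> (nat \<Rightarrow> real) \<Rightarrow> bool" where
  "in_Omega f g \<longleftrightarrow>
     (\<exists>C>0. \<forall>\<^sub>F n in sequentially. ereal (C * g n) \<le> ereal_of_enat (f n))"

end

theory Submission
  imports
    Defs
    "HOL-Combinatorics.Permutations"
    "HOL-Real_Asymp.Real_Asymp"
begin

text \<open>For a prime \<open>p\<close> with \<open>2 p\<^sup>2 < n\<close> let \<open>N\<^sub>p\<close> be the vectors of \<open>I\<^sub>n\<close> whose coordinate sum is
  divisible by \<open>p\<close>. It contains the root lattice \<open>A\<^sub>n\<^sub>-\<^sub>1\<close>, and an isolation \<open>L\<close> of \<open>I\<^sub>n\<close> admits a
  representation \<open>\<sigma>\<^sub>p\<close> of it. If a vector of \<open>L\<close> has the same norm and the same inner products with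
  \<open>\<sigma>\<^sub>p(A\<^sub>n\<^sub>-\<^sub>1)\<close> as some \<open>c \<in> I\<^sub>n - N\<^sub>p\<close> of small coordinate sum, then integrality and the
  Cauchy-Schwarz inequality force it to be the image of \<open>c\<close>, and \<open>\<sigma>\<^sub>p\<close> extends to \<open>I\<^sub>n\<close>, which is
  impossible. Applied to vectors of norm 1 and 2 this limits how they meet \<open>\<sigma>\<^sub>p(A\<^sub>n\<^sub>-\<^sub>1)\<close>. If the
  root lattices for two primes \<open>p \<noteq> q\<close> were not orthogonal, reflections of \<open>L\<close> would move one onto
  the other, and then \<open>\<sigma>\<^sub>q(q e\<^sub>0)\<close> would be such a vector for \<open>c = q e\<^sub>0\<close>. Hence all these copies of
  \<open>A\<^sub>n\<^sub>-\<^sub>1\<close>, the lattice \<open>D\<^sub>n = N\<^sub>2\<close> and \<open>I\<^sub>n\<^sub>-\<^sub>1\<close> are mutually orthogonal in \<open>L\<close>. The growth rate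
  follows from Chebyshev's lower bound for the number of primes.\<close>

subsection \<open>Integral forms and representations\<close>

lemma zmul_int [simp]: "zmul k (x::int) = k * x"
  by (induction k rule: int_induct[where k = 0]) (simp_all add: zmul_succ zmul_pred algebra_simps)

lemma zmul_fun [simp]: "zmul k (f :: 'a \<Rightarrow> int) i = k * f i"
  by (induction k rule: int_induct[where k = 0]) (simp_all add: zmul_succ zmul_pred algebra_simps)

text \<open>Requiring the domain to be a subgroup lets additivity alone yield compatibility with 0,
  differences, integer multiples and sums.\<close>

definition additive_on :: "'a::ab_group_add set \<Rightarrow> ('a \<Rightarrow> 'b::ab_group_add) \<Rightarrow> bool" where
  "additive_on S h \<longleftrightarrow> zmod.subspace S \<and> (\<forall>x\<in>S. \<forall>y\<in>S. h (x + y) = h x + h y)"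

lemma additive_on_add: "additive_on S h \<Longrightarrow> x \<in> S \<Longrightarrow> y \<in> S \<Longrightarrow> h (x + y) = h x + h y"
  by (simp add: additive_on_def)

lemma additive_on_0: "additive_on S h \<Longrightarrow> h 0 = 0"
  using additive_on_add[of S h 0 0] zmod.subspace_0[of S] by (auto simp: additive_on_def)

lemma additive_on_diff:
  assumes "additive_on S h" "x \<in> S" "y \<in> S"
  shows "h (x - y) = h x - h y"
proof -
  have "x - y \<in> S" using assms zmod.subspace_diff by (auto simp: additive_on_def)
  from additive_on_add[OF assms(1) this assms(3)] show ?thesis by simp
qed

lemma additive_on_minus: "additive_on S h \<Longrightarrow> x \<in> S \<Longrightarrow> h (- x) = - h x"
  using additive_on_diff[of S h 0 x] additive_on_0[of S h] zmod.subspace_0[of S]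
  by (auto simp: additive_on_def)

lemma additive_on_zmul:
  assumes "additive_on S h" "x \<in> S"
  shows "h (zmul k x) = zmul k (h x)"
proof -
  have mem: "zmul i x \<in> S" for i
    using assms zmod.subspace_scale by (auto simp: additive_on_def)
  show ?thesis
    by (induction k rule: int_induct[where k = 0])
      (simp_all add: zmul_succ zmul_pred additive_on_0[OF assms(1)]
        additive_on_add[OF assms(1)] additive_on_diff[OF assms(1)] mem assms(2))
qed

lemma additive_on_sum:
  assumes "additive_on S h" "finite I" "\<And>i. i \<in> I \<Longrightarrow> v i \<in> S"
  shows "h (\<Sum>i\<in>I. v i) = (\<Sum>i\<in>I. h (v i))"
  using assms(2,3)
proof (induction I)
  case empty
  then show ?case using additive_on_0[OF assms(1)] by simp
next
  case (insert i I)
  have "(\<Sum>i\<in>I. v i) \<in> S"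
    using assms(1) insert by (auto simp: additive_on_def intro!: zmod.subspace_sum)
  then show ?case using insert additive_on_add[OF assms(1)] by simp
qed

text \<open>The part of \<open>zlattice\<close> that polarization uses. Without basis and positivity
  it is quickly verified for sublattices of the cubic lattice and for orthogonal sums and
  powers.\<close>

definition zform :: "'a::ab_group_add zlat \<Rightarrow> bool" where
  "zform M \<longleftrightarrow> zmod.subspace (lvecs M) \<and>
     (\<forall>x\<in>lvecs M. \<forall>y\<in>lvecs M. lform M x y = lform M y x) \<and>
     (\<forall>x\<in>lvecs M. \<forall>y\<in>lvecs M. \<forall>z\<in>lvecs M. lform M (x + y) z = lform M x z + lform M y z)"

lemma zform_additive: "zform M \<Longrightarrow> z \<in> lvecs M \<Longrightarrow> additive_on (lvecs M) (\<lambda>x. lform M x z)"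
  by (simp add: zform_def additive_on_def)

lemma zlattice_zform: "zlattice L \<Longrightarrow> zform L"
  unfolding zlattice_def zform_def zbasis_def by (metis zmod.subspace_span)

definition rep :: "'b::ab_group_add zlat \<Rightarrow> 'a::ab_group_add zlat \<Rightarrow> ('a \<Rightarrow> 'b) \<Rightarrow> bool" where
  "rep L M \<sigma> \<longleftrightarrow> (\<forall>x\<in>lvecs M. \<sigma> x \<in> lvecs L) \<and>
     (\<forall>x\<in>lvecs M. \<forall>y\<in>lvecs M. \<sigma> (x + y) = \<sigma> x + \<sigma> y) \<and>
     (\<forall>x\<in>lvecs M. lquad L (\<sigma> x) = lquad M x)"

lemma represents_iff: "represents L M \<longleftrightarrow> (\<exists>\<sigma>. rep L M \<sigma>)"
  by (simp add: represents_def rep_def)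

lemma rep_mem: "rep L M \<sigma> \<Longrightarrow> x \<in> lvecs M \<Longrightarrow> \<sigma> x \<in> lvecs L"
  by (simp add: rep_def)

lemma rep_comp: "rep L M \<sigma> \<Longrightarrow> rep M N \<tau> \<Longrightarrow> rep L N (\<lambda>x. \<sigma> (\<tau> x))"
  by (simp add: rep_def)

lemma rep_additive: "rep L M \<sigma> \<Longrightarrow> zmod.subspace (lvecs M) \<Longrightarrow> additive_on (lvecs M) \<sigma>"
  by (simp add: rep_def additive_on_def)

lemma zform_quad_add:
  assumes "zform M" "x \<in> lvecs M" "y \<in> lvecs M"
  shows "lform M (x + y) (x + y) = lform M x x + 2 * lform M x y + lform M y y"
proof -
  have xy: "x + y \<in> lvecs M"
    using assms zmod.subspace_add by (auto simp: zform_def)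
  have add: "lform M (u + v) w = lform M u w + lform M v w"
    and sym: "lform M u v = lform M v u"
    if "u \<in> lvecs M" "v \<in> lvecs M" "w \<in> lvecs M" for u v w
    using assms(1) that by (simp_all add: zform_def)
  show ?thesis
    using add[OF assms(2,3) xy] sym[OF assms(2) xy xy] sym[OF assms(3) xy xy]
      add[OF assms(2,3,2)] add[OF assms(2,3,3)] sym[OF assms(2,3,3)] by simp
qed

text \<open>Polarization: expanding the norm of \<open>x + y\<close> on both sides leaves twice the
  inner product, and 2 cancels in the integers.\<close>

lemma rep_form:
  assumes "zform L" "zform M" "rep L M \<sigma>" "x \<in> lvecs M" "y \<in> lvecs M"
  shows "lform L (\<sigma> x) (\<sigma> y) = lform M x y"
proof -
  have xy: "x + y \<in> lvecs M"
    using assms zmod.subspace_add by (auto simp: zform_def)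
  have "lform L (\<sigma> x + \<sigma> y) (\<sigma> x + \<sigma> y) = lform M (x + y) (x + y)"
    using assms(3-5) xy unfolding rep_def lquad_def by metis
  moreover have "lform L (\<sigma> x) (\<sigma> x) = lform M x x" "lform L (\<sigma> y) (\<sigma> y) = lform M y y"
    using assms by (simp_all add: rep_def lquad_def)
  ultimately show ?thesis
    using zform_quad_add[OF assms(2,4,5)]
      zform_quad_add[OF assms(1) rep_mem[OF assms(3,4)] rep_mem[OF assms(3,5)]] by simp
qed

section \<open>Calculations in a positive definite lattice\<close>

locale pos_lattice =
  fixes L :: "'b::ab_group_add zlat"
  assumes zlattice: "zlattice L"
begin

abbreviation "V \<equiv> lvecs L"
abbreviation "B \<equiv> lform L"

lemma zform: "zform L"
  using zlattice by (rule zlattice_zform)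

lemma subspace: "zmod.subspace V"
  using zform by (simp add: zform_def)

lemma mem [simp]:
  "0 \<in> V" "x \<in> V \<Longrightarrow> y \<in> V \<Longrightarrow> x + y \<in> V" "x \<in> V \<Longrightarrow> y \<in> V \<Longrightarrow> x - y \<in> V"
  "x \<in> V \<Longrightarrow> - x \<in> V" "x \<in> V \<Longrightarrow> zmul k x \<in> V"
  by (rule zmod.subspace_0[OF subspace] zmod.subspace_add[OF subspace]
      zmod.subspace_diff[OF subspace] zmod.subspace_neg[OF subspace]
      zmod.subspace_scale[OF subspace]; assumption)+

lemma mem_sum [simp]: "(\<And>i. i \<in> I \<Longrightarrow> v i \<in> V) \<Longrightarrow> (\<Sum>i\<in>I. v i) \<in> V"
  by (rule zmod.subspace_sum[OF subspace])

lemma sym: "x \<in> V \<Longrightarrow> y \<in> V \<Longrightarrow> B x y = B y x"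
  using zform by (simp add: zform_def)

lemma additive_left: "z \<in> V \<Longrightarrow> additive_on V (\<lambda>x. B x z)"
  using zform zform_additive by blast

lemma additive_right: "z \<in> V \<Longrightarrow> additive_on V (B z)"
  using additive_left sym mem(2) unfolding additive_on_def by metis

lemma form_left [simp]:
  assumes "z \<in> V"
  shows "B 0 z = 0" "x \<in> V \<Longrightarrow> y \<in> V \<Longrightarrow> B (x + y) z = B x z + B y z"
    "x \<in> V \<Longrightarrow> y \<in> V \<Longrightarrow> B (x - y) z = B x z - B y z"
    "x \<in> V \<Longrightarrow> B (- x) z = - B x z" "x \<in> V \<Longrightarrow> B (zmul k x) z = k * B x z"
  by (simp_all add: additive_on_0[OF additive_left[OF assms]]
      additive_on_add[OF additive_left[OF assms]] additive_on_diff[OF additive_left[OF assms]]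
      additive_on_minus[OF additive_left[OF assms]] additive_on_zmul[OF additive_left[OF assms]])

lemma form_right [simp]:
  assumes "z \<in> V"
  shows "B z 0 = 0" "x \<in> V \<Longrightarrow> y \<in> V \<Longrightarrow> B z (x + y) = B z x + B z y"
    "x \<in> V \<Longrightarrow> y \<in> V \<Longrightarrow> B z (x - y) = B z x - B z y"
    "x \<in> V \<Longrightarrow> B z (- x) = - B z x" "x \<in> V \<Longrightarrow> B z (zmul k x) = k * B z x"
  using assms by (simp_all add: sym[of z])

lemma form_sum_right:
  assumes "z \<in> V" "finite I" "\<And>i. i \<in> I \<Longrightarrow> v i \<in> V"
  shows "B z (\<Sum>i\<in>I. v i) = (\<Sum>i\<in>I. B z (v i))"
  using additive_on_sum[OF additive_right[OF assms(1)] assms(2,3)] .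

lemma form_sum_left:
  assumes "z \<in> V" "finite I" "\<And>i. i \<in> I \<Longrightarrow> v i \<in> V"
  shows "B (\<Sum>i\<in>I. v i) z = (\<Sum>i\<in>I. B (v i) z)"
  using additive_on_sum[OF additive_left[OF assms(1)] assms(2,3)] .

lemma form_pos: "x \<in> V \<Longrightarrow> x \<noteq> 0 \<Longrightarrow> 0 < B x x"
  using zlattice by (simp add: zlattice_def)

lemma form_nonneg [simp]: "x \<in> V \<Longrightarrow> 0 \<le> B x x"
  using form_pos[of x] by (cases "x = 0") auto

lemma form_eq_0: "x \<in> V \<Longrightarrow> B x x = 0 \<Longrightarrow> x = 0"
  using form_pos[of x] by (cases "x = 0") auto

text \<open>Since the form is integral, the reflection in a vector of norm 2 preserves the lattice.\<close>

definition refl :: "'b \<Rightarrow> 'b \<Rightarrow> 'b" where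
  "refl r x = x - zmul (B x r) r"

lemma rep_refl:
  assumes r: "r \<in> V" "B r r = 2"
  shows "rep L L (refl r)"
  unfolding rep_def lquad_def refl_def
proof (intro conjI ballI)
  fix x y assume "x \<in> V" "y \<in> V"
  then show "x + y - zmul (B (x + y) r) r = x - zmul (B x r) r + (y - zmul (B y r) r)"
    using r by (simp add: zmul_add_left)
next
  fix x assume x: "x \<in> V"
  then show "x - zmul (B x r) r \<in> V" using r by simp
  show "B (x - zmul (B x r) r) (x - zmul (B x r) r) = B x x"
    using r x sym[OF r(1) x] by simp
qed

lemma rep_uminus: "rep L L uminus"
  by (auto simp: rep_def lquad_def)

end

subsection \<open>Sublattices of the cubic lattice given by the coordinate sum\<close>

definition coord_sum :: "nat \<Rightarrow> (nat \<Rightarrow> int) \<Rightarrow> int" where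
  "coord_sum n x = (\<Sum>i<n. x i)"

definition unit_vec :: "nat \<Rightarrow> nat \<Rightarrow> int" where
  "unit_vec i = (\<lambda>j. if j = i then 1 else 0)"

text \<open>The moduli 0, 1, 2 give the lattices \<open>A\<^sub>n\<^sub>-\<^sub>1\<close>, \<open>I\<^sub>n\<close> and \<open>D\<^sub>n\<close>.\<close>

definition cong_lattice :: "nat \<Rightarrow> nat \<Rightarrow> (nat \<Rightarrow> int) zlat" where
  "cong_lattice n p = \<lparr>lvecs = {x \<in> int_vecs n. int p dvd coord_sum n x}, lform = dot n\<rparr>"

lemma cong_lattice_0: "0 < n \<Longrightarrow> cong_lattice n 0 = A_lattice (n - 1)"
  by (simp add: cong_lattice_def A_lattice_def coord_sum_def)

lemma cong_lattice_1: "cong_lattice n 1 = cubic_lattice n"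
  by (simp add: cong_lattice_def cubic_lattice_def)

lemma cong_lattice_2: "cong_lattice n 2 = D_lattice n"
  by (simp add: cong_lattice_def D_lattice_def coord_sum_def)

lemma mem_cong_lattice [simp]:
  "x \<in> lvecs (cong_lattice n p) \<longleftrightarrow> x \<in> int_vecs n \<and> int p dvd coord_sum n x"
  by (simp add: cong_lattice_def)

lemma lform_cong_lattice [simp]: "lform (cong_lattice n p) = dot n"
  by (simp add: cong_lattice_def)

lemma coord_sum_simps [simp]:
  "coord_sum n 0 = 0" "coord_sum n (x + y) = coord_sum n x + coord_sum n y"
  "coord_sum n (x - y) = coord_sum n x - coord_sum n y" "coord_sum n (- x) = - coord_sum n x"
  "coord_sum n (zmul k x) = k * coord_sum n x" "i < n \<Longrightarrow> coord_sum n (unit_vec i) = 1"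
  "coord_sum n (\<lambda>i. 1) = int n"
  by (simp_all add: coord_sum_def unit_vec_def sum.distrib sum_subtractf sum_negf sum_distrib_left)

lemma int_vecs_simps [simp]:
  "0 \<in> int_vecs n" "x \<in> int_vecs n \<Longrightarrow> y \<in> int_vecs n \<Longrightarrow> x + y \<in> int_vecs n"
  "x \<in> int_vecs n \<Longrightarrow> y \<in> int_vecs n \<Longrightarrow> x - y \<in> int_vecs n"
  "x \<in> int_vecs n \<Longrightarrow> - x \<in> int_vecs n" "x \<in> int_vecs n \<Longrightarrow> zmul k x \<in> int_vecs n"
  "i < n \<Longrightarrow> unit_vec i \<in> int_vecs n"
  by (simp_all add: int_vecs_def unit_vec_def)

lemma dot_commute: "dot n x y = dot n y x"
  by (simp add: dot_def mult.commute)

lemma dot_left [simp]: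
  "dot n 0 z = 0" "dot n (x + y) z = dot n x z + dot n y z"
  "dot n (x - y) z = dot n x z - dot n y z" "dot n (- x) z = - dot n x z"
  "dot n (zmul k x) z = k * dot n x z" "i < n \<Longrightarrow> dot n (unit_vec i) z = z i"
  by (simp_all add: dot_def unit_vec_def sum.distrib sum_subtractf sum_negf sum_distrib_left
      algebra_simps if_distrib[of "(*) _"] cong: if_cong)

lemma dot_right [simp]:
  "dot n z 0 = 0" "dot n z (x + y) = dot n z x + dot n z y"
  "dot n z (x - y) = dot n z x - dot n z y" "dot n z (- x) = - dot n z x"
  "dot n z (zmul k x) = k * dot n z x" "i < n \<Longrightarrow> dot n z (unit_vec i) = z i"
  by (simp_all add: dot_commute[of n z])

lemma zform_cong_lattice [simp]: "zform (cong_lattice n p)"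
  by (auto simp: zform_def dot_commute intro!: zmod.subspaceI)

lemma subspace_cong_lattice: "zmod.subspace (lvecs (cong_lattice n p))"
  using zform_cong_lattice by (simp add: zform_def)

lemma int_vecs_decomp:
  assumes "x \<in> int_vecs n"
  shows "x = (\<Sum>i<n. zmul (x i) (unit_vec i))"
proof
  fix j
  have "(\<Sum>i<n. zmul (x i) (unit_vec i)) j = (\<Sum>i<n. zmul (x i) (unit_vec i) j)"
    by (induction n) simp_all
  then show "x j = (\<Sum>i<n. zmul (x i) (unit_vec i)) j"
    using assms by (cases "j < n") (simp_all add: unit_vec_def int_vecs_def if_distrib[of "(*) _"] cong: if_cong)
qed

text \<open>The coefficients sum to 0, so subtracting \<open>unit_vec 0\<close> from every generator
  changes nothing. Hence an additive map on the root lattice is determined by its values on these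
  differences.\<close>

lemma root_decomp:
  assumes "x \<in> lvecs (cong_lattice n 0)"
  shows "x = (\<Sum>i<n. zmul (x i) (unit_vec i - unit_vec 0))"
proof -
  have "(\<Sum>i<n. zmul (x i) (unit_vec i - unit_vec 0)) =
      (\<Sum>i<n. zmul (x i) (unit_vec i)) - zmul (\<Sum>i<n. x i) (unit_vec 0)"
    by (simp only: zmod.scale_right_diff_distrib sum_subtractf zmod.scale_sum_left)
  then show ?thesis
    using assms int_vecs_decomp[of x n] by (simp add: coord_sum_def)
qed

text \<open>Divisibility of moduli reverses inclusion, so the same map restricts. Every modulus
  divides 0, hence every \<open>\<sigma>\<close> restricts to the root lattice.\<close>

lemma rep_cong_mono:
  assumes "rep L (cong_lattice n p) \<sigma>" "p dvd q"
  shows "rep L (cong_lattice n q) \<sigma>"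
proof -
  have "int p dvd int q" using assms(2) by simp
  then have "x \<in> lvecs (cong_lattice n p)" if "x \<in> lvecs (cong_lattice n q)" for x
    using that dvd_trans by (metis mem_cong_lattice)
  then show ?thesis
    using assms(1) unfolding rep_def lquad_def lform_cong_lattice by (simp del: mem_cong_lattice)
qed

lemma (in pos_lattice) root_additive_dot:
  assumes \<sigma>: "rep L (cong_lattice n p) \<sigma>" and x: "x \<in> lvecs (cong_lattice n 0)"
    and n: "0 < n" and y: "y \<in> V"
  shows "B y (\<sigma> x) = (\<Sum>i<n. x i * B y (\<sigma> (unit_vec i - unit_vec 0)))"
proof -
  have mem: "zmul (x i) (unit_vec i - unit_vec 0) \<in> lvecs (cong_lattice n p)"
    "unit_vec i - unit_vec 0 \<in> lvecs (cong_lattice n p)" if "i < n" for i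
    using that n by simp_all
  have add: "additive_on (lvecs (cong_lattice n p)) \<sigma>"
    by (rule rep_additive[OF \<sigma> subspace_cong_lattice])
  have "\<sigma> x = \<sigma> (\<Sum>i<n. zmul (x i) (unit_vec i - unit_vec 0))"
    using root_decomp[OF x] by simp
  also have "\<dots> = (\<Sum>i<n. zmul (x i) (\<sigma> (unit_vec i - unit_vec 0)))"
    by (subst additive_on_sum[OF add])
      (use mem in \<open>auto simp: additive_on_zmul[OF add] simp del: mem_cong_lattice intro!: sum.cong\<close>)
  finally have "B y (\<sigma> x) = B y (\<Sum>i<n. zmul (x i) (\<sigma> (unit_vec i - unit_vec 0)))" by simp
  also have "\<dots> = (\<Sum>i<n. B y (zmul (x i) (\<sigma> (unit_vec i - unit_vec 0))))"
    using rep_mem[OF \<sigma> mem(2)] y by (intro form_sum_right) auto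
  also have "\<dots> = (\<Sum>i<n. x i * B y (\<sigma> (unit_vec i - unit_vec 0)))"
    using rep_mem[OF \<sigma> mem(2)] y by (intro sum.cong) auto
  finally show ?thesis .
qed

section \<open>Extending a representation to the cubic lattice\<close>

context pos_lattice
begin

lemma rep_dot:
  "rep L (cong_lattice n p) \<sigma> \<Longrightarrow> x \<in> lvecs (cong_lattice n p) \<Longrightarrow> y \<in> lvecs (cong_lattice n p)
    \<Longrightarrow> B (\<sigma> x) (\<sigma> y) = dot n x y"
  using rep_form[OF zform zform_cong_lattice] by (metis lform_cong_lattice)

lemma rep_linear:
  assumes "rep L (cong_lattice n p) \<sigma>"
  shows "x \<in> lvecs (cong_lattice n p) \<Longrightarrow> \<sigma> (zmul k x) = zmul k (\<sigma> x)"
    "x \<in> lvecs (cong_lattice n p) \<Longrightarrow> \<sigma> (- x) = - \<sigma> x"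
    "x \<in> lvecs (cong_lattice n p) \<Longrightarrow> y \<in> lvecs (cong_lattice n p) \<Longrightarrow> \<sigma> (x + y) = \<sigma> x + \<sigma> y"
    "x \<in> lvecs (cong_lattice n p) \<Longrightarrow> y \<in> lvecs (cong_lattice n p) \<Longrightarrow> \<sigma> (x - y) = \<sigma> x - \<sigma> y"
proof -
  note add = rep_additive[OF assms subspace_cong_lattice]
  show "x \<in> lvecs (cong_lattice n p) \<Longrightarrow> \<sigma> (zmul k x) = zmul k (\<sigma> x)"
    by (rule additive_on_zmul[OF add])
  show "x \<in> lvecs (cong_lattice n p) \<Longrightarrow> \<sigma> (- x) = - \<sigma> x"
    by (rule additive_on_minus[OF add])
  show "x \<in> lvecs (cong_lattice n p) \<Longrightarrow> y \<in> lvecs (cong_lattice n p) \<Longrightarrow> \<sigma> (x + y) = \<sigma> x + \<sigma> y"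
    by (rule additive_on_add[OF add])
  show "x \<in> lvecs (cong_lattice n p) \<Longrightarrow> y \<in> lvecs (cong_lattice n p) \<Longrightarrow> \<sigma> (x - y) = \<sigma> x - \<sigma> y"
    by (rule additive_on_diff[OF add])
qed

text \<open>If \<open>y\<close> behaves as the image of \<open>c\<close>, then \<open>\<sigma>\<close> extends to \<open>N\<^sub>p + \<int> c = I\<^sub>n\<close>.\<close>

lemma rep_extend:
  assumes \<sigma>: "rep L (cong_lattice n p) \<sigma>" and p: "prime p"
    and c: "c \<in> int_vecs n" and y: "y \<in> V"
    and eq: "zmul (int p) y = \<sigma> (zmul (int p) c)"
    and ndvd: "\<not> int p dvd coord_sum n c"
  shows "represents L (cubic_lattice n)"
proof -
  define m where "m = coord_sum n c"
  have "coprime (int p) m"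
    using p ndvd by (simp add: m_def prime_imp_coprime)
  then obtain a b where ab: "a * int p + b * m = 1"
    using coprime_iff_gcd_eq_1 bezout_int[of "int p" m] by metis
  have p0: "int p \<noteq> 0" using p by auto
  \<comment> \<open>By the Bezout relation \<open>b * m\<close> is 1 modulo \<open>p\<close>, so
    subtracting this multiple of \<open>c\<close> makes the coordinate sum divisible by
    \<open>p\<close>.\<close>
  define r where "r x = x - zmul (b * coord_sum n x) c" for x
  have r_mem: "r x \<in> lvecs (cong_lattice n p)" if "x \<in> int_vecs n" for x
  proof -
    have "coord_sum n (r x) = coord_sum n x * (1 - b * m)"
      by (simp add: r_def m_def algebra_simps)
    also have "1 - b * m = a * int p" using ab by simp
    finally have "coord_sum n (r x) = coord_sum n x * (a * int p)" .
    then show ?thesis using that c by (simp add: r_def)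
  qed
  have pc: "zmul (int p) c \<in> lvecs (cong_lattice n p)" using c by simp
  \<comment> \<open>As \<open>c\<close> lies outside \<open>N\<^sub>p\<close>, products with
    \<open>y\<close> are computed for \<open>p\<close> times \<open>y\<close>, and \<open>p\<close>
    is cancelled.\<close>
  have dot_y: "B (\<sigma> v) y = dot n v c" if v: "v \<in> lvecs (cong_lattice n p)" for v
  proof -
    have "int p * B (\<sigma> v) y = B (\<sigma> v) (\<sigma> (zmul (int p) c))"
      using rep_mem[OF \<sigma> v] y by (simp flip: eq)
    also have "\<dots> = int p * dot n v c"
      using rep_dot[OF \<sigma> v pc] by simp
    finally show ?thesis using p0 by simp
  qed
  have norm_y: "B y y = dot n c c"
  proof -
    have "int p * (int p * B y y) = B (zmul (int p) y) (zmul (int p) y)"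
      using y by simp
    also have "\<dots> = int p * (int p * dot n c c)"
      using rep_dot[OF \<sigma> pc pc] by (simp add: eq)
    finally show ?thesis using p0 by simp
  qed
  have "rep L (cubic_lattice n) (\<lambda>x. \<sigma> (r x) + zmul (b * coord_sum n x) y)"
    unfolding rep_def
  proof (intro conjI ballI)
    fix x assume "x \<in> lvecs (cubic_lattice n)"
    then have x: "x \<in> int_vecs n" by (simp add: cubic_lattice_def)
    note rx = r_mem[OF x] and srx = rep_mem[OF \<sigma> r_mem[OF x]]
    show "\<sigma> (r x) + zmul (b * coord_sum n x) y \<in> V"
      using srx y by simp
    have "lquad L (\<sigma> (r x) + zmul (b * coord_sum n x) y) =
        dot n (r x + zmul (b * coord_sum n x) c) (r x + zmul (b * coord_sum n x) c)"
      using srx y sym[OF y srx] rep_dot[OF \<sigma> rx rx] dot_y[OF rx] norm_y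
      by (simp add: lquad_def dot_commute[of n c "r x"] del: mem_cong_lattice)
    then show "lquad L (\<sigma> (r x) + zmul (b * coord_sum n x) y) = lquad (cubic_lattice n) x"
      by (simp add: r_def lquad_def cubic_lattice_def)
  next
    fix x z assume "x \<in> lvecs (cubic_lattice n)" "z \<in> lvecs (cubic_lattice n)"
    then have "x \<in> int_vecs n" "z \<in> int_vecs n" by (simp_all add: cubic_lattice_def)
    moreover have "r (x + z) = r x + r z"
      by (simp add: r_def algebra_simps zmul_add_left)
    ultimately show "\<sigma> (r (x + z)) + zmul (b * coord_sum n (x + z)) y =
        \<sigma> (r x) + zmul (b * coord_sum n x) y + (\<sigma> (r z) + zmul (b * coord_sum n z) y)"
      using rep_linear(3)[OF \<sigma> r_mem r_mem, of x z]
      by (simp add: zmul_add_left distrib_left)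
  qed
  then show ?thesis by (auto simp: represents_iff)
qed

text \<open>The inner products of \<open>y\<close> with \<open>\<sigma> (p e\<^sub>i)\<close> differ from those of \<open>c\<close> by a constant \<open>\<delta>\<close>,
  and positivity of the norm of \<open>p\<^sup>2 y - \<sigma> (p\<^sup>2 c + \<delta> p (1, \<dots>, 1))\<close> forces \<open>\<delta> = 0\<close>.\<close>

lemma represents_cubic_if_root_products:
  assumes \<sigma>: "rep L (cong_lattice n p) \<sigma>" and p: "prime p"
    and c: "c \<in> int_vecs n" and y: "y \<in> V"
    and norm: "B y y = dot n c c"
    and prod: "\<And>x. x \<in> lvecs (cong_lattice n 0) \<Longrightarrow> B y (\<sigma> x) = dot n c x"
    and ndvd: "\<not> int p dvd coord_sum n c"
    and small: "2 * int p * \<bar>coord_sum n c\<bar> < int n"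
  shows "represents L (cubic_lattice n)"
proof -
  define P where "P = int p"
  define m where "m = coord_sum n c"
  have P: "0 < P" using prime_gt_0_nat[OF p] by (simp add: P_def)
  have "0 \<le> 2 * P * \<bar>m\<bar>" using P by simp
  then have n: "0 < n" using small unfolding P_def m_def by linarith
  define e where "e = zmul P (unit_vec 0)"
  define \<delta> where "\<delta> = B y (\<sigma> (e)) - P * c 0"
  have e: "e \<in> lvecs (cong_lattice n p)" and sum_e: "coord_sum n e = P" and dot_e: "dot n c e = P * c 0"
    using n by (simp_all add: e_def P_def)
  \<comment> \<open>\<open>v\<close> minus \<open>k\<close> times \<open>e\<close> has coordinate
    sum 0, so \<open>prod\<close> applies to it; each copy of \<open>e\<close> contributes one
    defect \<open>\<delta>\<close>.\<close>
  have shift: "B y (\<sigma> v) = dot n c v + k * \<delta>"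
    if v: "v \<in> lvecs (cong_lattice n p)" "coord_sum n v = k * P" for v k
  proof -
    define u where "u = v - zmul k (e)"
    have u: "u \<in> lvecs (cong_lattice n 0)" using v e by (simp add: u_def sum_e)
    have u': "u \<in> lvecs (cong_lattice n p)" using u by simp
    have ke: "zmul k (e) \<in> lvecs (cong_lattice n p)"
      using e by (simp add: dvd_mult)
    have "\<sigma> v = \<sigma> u + zmul k (\<sigma> (e))"
      using rep_linear(3)[OF \<sigma> u' ke] rep_linear(1)[OF \<sigma> e] by (simp add: u_def)
    then have "B y (\<sigma> v) = dot n c u + k * (\<delta> + P * c 0)"
      using rep_mem[OF \<sigma> u'] rep_mem[OF \<sigma> e] y prod[OF u] by (simp add: \<delta>_def)
    also have "\<dots> = dot n c v + k * \<delta>"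
      by (simp add: u_def dot_e algebra_simps)
    finally show ?thesis .
  qed
  define one where "one = (\<lambda>i. if i < n then 1 else (0::int))"
  have one: "one \<in> int_vecs n" "coord_sum n one = int n" "dot n one z = coord_sum n z" for z
    by (auto simp: one_def int_vecs_def coord_sum_def dot_def)
  \<comment> \<open>By \<open>shift\<close>, the orthogonal projection of \<open>y\<close> to the
    rational span of the image of \<open>\<sigma>\<close> corresponds to c + (\<delta> / P) (1, ...,
    1). The factor P^2 clears the denominator and brings the vector into
    \<open>N\<^sub>p\<close>.\<close>
  define v where "v = zmul (P\<^sup>2) c + zmul (\<delta> * P) one"
  have v: "v \<in> lvecs (cong_lattice n p)"
    using c one by (simp add: v_def P_def power2_eq_square)
  have sumv: "coord_sum n v = (P * m + int n * \<delta>) * P"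
    using one by (simp add: v_def m_def algebra_simps power2_eq_square)
  note sv = rep_mem[OF \<sigma> v]
  have cv: "dot n c v = P\<^sup>2 * dot n c c + \<delta> * P * m"
    using one by (simp add: v_def m_def dot_commute[of n c one])
  have vv: "dot n v v = P\<^sup>2 * (P\<^sup>2 * dot n c c + \<delta> * P * m) + \<delta> * P * (P\<^sup>2 * m + \<delta> * P * int n)"
    using one cv by (simp add: v_def m_def dot_commute[of n c one])
  have "B (zmul (P\<^sup>2) y - \<sigma> v) (zmul (P\<^sup>2) y - \<sigma> v) =
      P\<^sup>2 * (P\<^sup>2 * B y y) - 2 * (P\<^sup>2 * B y (\<sigma> v)) + B (\<sigma> v) (\<sigma> v)"
    using y sv sym[OF sv y] by (simp add: algebra_simps)
  also have "\<dots> = P\<^sup>2 * (- (2 * P * m * \<delta>) - int n * \<delta>\<^sup>2)"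
    unfolding norm shift[OF v sumv] cv rep_dot[OF \<sigma> v v] vv
    by (simp add: algebra_simps power2_eq_square)
  finally have "0 \<le> P\<^sup>2 * (- (2 * P * m * \<delta>) - int n * \<delta>\<^sup>2)"
    using form_nonneg[of "zmul (P\<^sup>2) y - \<sigma> v"] y sv by simp
  then have ge: "int n * \<delta>\<^sup>2 \<le> - (2 * P * m * \<delta>)"
    using P by (simp add: zero_le_mult_iff)
  \<comment> \<open>A nonzero integer has absolute value at least 1, so \<open>ge\<close> would give
    n <= 2 P |m|, contrary to \<open>small\<close>.\<close>
  have "\<delta> = 0"
  proof (rule ccontr)
    assume \<delta>: "\<delta> \<noteq> 0"
    have "int n * \<bar>\<delta>\<bar> * \<bar>\<delta>\<bar> \<le> \<bar>2 * P * m * \<delta>\<bar>"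
      using ge by (simp add: power2_eq_square mult.assoc abs_mult_self_eq)
    also have "\<dots> = 2 * P * \<bar>m\<bar> * \<bar>\<delta>\<bar>"
      using P by (simp add: abs_mult)
    finally have "int n * \<bar>\<delta>\<bar> \<le> 2 * P * \<bar>m\<bar>" using \<delta> by simp
    moreover have "int n * 1 \<le> int n * \<bar>\<delta>\<bar>" using \<delta> by (intro mult_left_mono) auto
    ultimately show False using small by (simp add: P_def m_def)
  qed
  have w: "zmul P c \<in> lvecs (cong_lattice n p)" using c by (simp add: P_def)
  note sw = rep_mem[OF \<sigma> w]
  have "B y (\<sigma> (zmul P c)) = P * dot n c c"
    using shift[OF w, of m] \<open>\<delta> = 0\<close> by (simp add: m_def)
  then have "B (zmul P y - \<sigma> (zmul P c)) (zmul P y - \<sigma> (zmul P c)) = 0"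
    using y sw sym[OF sw y] rep_dot[OF \<sigma> w w] norm by (simp add: algebra_simps)
  then have "zmul P y = \<sigma> (zmul P c)"
    using form_eq_0[of "zmul P y - \<sigma> (zmul P c)"] y sw by simp
  then show ?thesis
    using rep_extend[OF \<sigma> p c y _ ndvd] by (simp add: P_def)
qed

end

subsection \<open>Vectors of norm 1 and 2\<close>

text \<open>Termwise |k| <= k^2, which holds because the entries are integers.\<close>

lemma abs_sum_le_sum_squares:
  fixes c :: "'a \<Rightarrow> int"
  shows "\<bar>\<Sum>i\<in>I. c i\<bar> \<le> (\<Sum>i\<in>I. c i * c i)"
proof -
  have "\<bar>k\<bar> \<le> k * k" for k :: int
    using mult_mono[of 1 "\<bar>k\<bar>" "\<bar>k\<bar>" "\<bar>k\<bar>"] by (cases "k = 0") (auto simp: abs_mult_self_eq)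
  then have "(\<Sum>i\<in>I. \<bar>c i\<bar>) \<le> (\<Sum>i\<in>I. c i * c i)" by (intro sum_mono)
  then show ?thesis using sum_abs[of c I] by linarith
qed

lemma abs_coord_sum_le: "\<bar>coord_sum n c\<bar> \<le> dot n c c"
  unfolding coord_sum_def dot_def by (rule abs_sum_le_sum_squares)

lemma dot_nonneg: "0 \<le> dot n c c"
  by (simp add: dot_def sum_nonneg)

text \<open>An integer and its square have the same parity. With \<open>abs_coord_sum_le\<close>
  this leaves only 1 and -1 as coordinate sums for norm 1, and 0, 2, -2 for norm 2.\<close>

lemma even_dot_iff: "even (dot n c c) \<longleftrightarrow> even (coord_sum n c)"
  unfolding dot_def coord_sum_def by (induction n) auto

lemma dot_eq_0_iff: "dot n c c = 0 \<longleftrightarrow> (\<forall>i<n. c i = 0)"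
  unfolding dot_def by (subst sum_nonneg_eq_0_iff) auto

text \<open>Coordinate permutations are isometries that preserve the coordinate sum; composing with
  them carries statements about one root to the others.\<close>

lemma rep_permute:
  assumes "\<pi> permutes {..<n}"
  shows "rep (cong_lattice n p) (cong_lattice n p) (\<lambda>x. x \<circ> \<pi>)"
proof -
  have sum: "(\<Sum>i<n. g (\<pi> i)) = (\<Sum>i<n. g i)" for g :: "nat \<Rightarrow> int"
    using sum.permute[OF assms, of g] by (simp add: comp_def)
  have "x \<circ> \<pi> \<in> int_vecs n" if "x \<in> int_vecs n" for x
    using that permutes_not_in[OF assms] by (simp add: int_vecs_def)
  moreover have "coord_sum n (x \<circ> \<pi>) = coord_sum n x" for x
    using sum[of x] by (simp add: coord_sum_def)
  moreover have "dot n (x \<circ> \<pi>) (x \<circ> \<pi>) = dot n x x" for x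
    using sum[of "\<lambda>i. x i * x i"] by (simp add: dot_def)
  ultimately show ?thesis by (auto simp: rep_def lquad_def fun_eq_iff)
qed

lemma unit_vec_transpose: "unit_vec k \<circ> transpose i j = unit_vec (transpose i j k)"
  by (auto simp: unit_vec_def fun_eq_iff transpose_def)

context pos_lattice
begin

text \<open>Shifting the inner products of \<open>y\<close> with the roots by a constant makes their sum at most
  \<open>n / 2\<close>; then Bessel's inequality for the projection to the root lattice leaves no room
  beyond the norm of \<open>y\<close>.\<close>

lemma short_vector_products:
  assumes \<sigma>: "rep L (cong_lattice n p) \<sigma>" and n: "16 < n" and y: "y \<in> V" and y2: "B y y \<le> 2"
  obtains c where "c \<in> int_vecs n" "dot n c c \<le> B y y"
    "\<And>x. x \<in> lvecs (cong_lattice n 0) \<Longrightarrow> B y (\<sigma> x) = dot n c x"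
proof -
  define b where "b i = B y (\<sigma> (unit_vec i - unit_vec 0))" for i
  define M where "M = (\<Sum>i<n. b i)"
  \<comment> \<open>The integer nearest to M / n; it makes 2 |m| <= n. Subtracting a constant from
    all coordinates does not affect products with vectors of coordinate sum 0.\<close>
  define k where "k = (2 * M + int n) div (2 * int n)"
  define c where "c i = (if i < n then b i - k else 0)" for i
  define m where "m = coord_sum n c"
  define S where "S = dot n c c"
  have c: "c \<in> int_vecs n" by (simp add: c_def int_vecs_def)
  have prod: "B y (\<sigma> x) = dot n c x" if x: "x \<in> lvecs (cong_lattice n 0)" for x
  proof -
    have "dot n c x = (\<Sum>i<n. x i * b i) - k * coord_sum n x"
      by (simp add: dot_def c_def coord_sum_def sum_distrib_left sum_subtractf[symmetric] algebra_simps)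
    then show ?thesis
      using root_additive_dot[OF \<sigma> x _ y] x n by (simp add: b_def)
  qed
  have "m = M - int n * k"
    by (simp add: m_def coord_sum_def c_def M_def sum_subtractf)
  moreover have "2 * M + int n = 2 * int n * k + (2 * M + int n) mod (2 * int n)"
    unfolding k_def by simp
  moreover have "0 \<le> (2 * M + int n) mod (2 * int n)" "(2 * M + int n) mod (2 * int n) < 2 * int n"
    using n by simp_all
  ultimately have m_n: "2 * \<bar>m\<bar> \<le> int n" by linarith
  define one where "one = (\<lambda>i. if i < n then 1 else (0::int))"
  have one: "one \<in> int_vecs n" "coord_sum n one = int n" "dot n one z = coord_sum n z" for z
    by (auto simp: one_def int_vecs_def coord_sum_def dot_def)
  \<comment> \<open>This is \<open>n\<close> times the orthogonal projection of \<open>c\<close> to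
    the hyperplane of coordinate sum 0.\<close>
  define x where "x = zmul (int n) c - zmul m one"
  have x: "x \<in> lvecs (cong_lattice n 0)" using c one by (simp add: x_def m_def)
  then have x': "x \<in> lvecs (cong_lattice n p)" by simp
  have cx: "dot n c x = int n * S - m * m"
    using one by (simp add: x_def S_def m_def dot_commute[of n c one])
  have "dot n one x = 0" using x one by simp
  then have xx: "dot n x x = int n * (int n * S - m * m)"
    unfolding x_def dot_left using cx by (simp add: x_def)
  note sx = rep_mem[OF \<sigma> x']
  have "B (zmul (int n) y - \<sigma> x) (zmul (int n) y - \<sigma> x) =
      int n * (int n * B y y) - 2 * (int n * B y (\<sigma> x)) + B (\<sigma> x) (\<sigma> x)"
    using y sx sym[OF sx y] by (simp add: algebra_simps)
  also have "\<dots> = int n * (int n * B y y - int n * S + m * m)"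
    unfolding prod[OF x] cx rep_dot[OF \<sigma> x' x'] xx by (simp add: algebra_simps)
  finally have "0 \<le> int n * (int n * B y y - int n * S + m * m)"
    using form_nonneg[of "zmul (int n) y - \<sigma> x"] y sx by simp
  then have bessel: "int n * S \<le> int n * B y y + m * m"
    using n by (simp add: zero_le_mult_iff)
  have mS: "\<bar>m\<bar> \<le> S" unfolding m_def S_def by (rule abs_coord_sum_le)
  \<comment> \<open>Two rounds: m^2 <= n S / 2 in \<open>bessel\<close> gives the crude bound S <=
    4. Then m^2 <= 16 < n, so the error term in \<open>bessel\<close> is less than \<open>n\<close>
    and integrality gives \<open>S \<le> B y y\<close>.\<close>
  have "2 * (m * m) = (2 * \<bar>m\<bar>) * \<bar>m\<bar>" by (simp add: abs_mult_self_eq)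
  also have "\<dots> \<le> int n * S" using m_n mS by (intro mult_mono) auto
  finally have "int n * S \<le> int n * (2 * B y y)" using bessel by simp
  then have "S \<le> 4" using n y2 by (simp add: mult_le_cancel_left)
  then have "\<bar>m\<bar> * \<bar>m\<bar> \<le> 4 * 4" using mS by (intro mult_mono) auto
  then have "int n * S < int n * (B y y + 1)"
    using bessel n by (simp add: abs_mult_self_eq distrib_left)
  then have "S \<le> B y y" using n by (simp add: mult_less_cancel_left)
  then show thesis using that[OF c _ prod] by (simp add: S_def)
qed

text \<open>If \<open>c\<close> had norm 1, its coordinate sum would be 1 or -1, hence prime to
  \<open>p\<close> and small, and \<open>\<sigma>\<close> would extend with \<open>y\<close> as the
  image of \<open>c\<close>. So \<open>c\<close> vanishes.\<close>

lemma unit_norm_orth_roots: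
  assumes \<sigma>: "rep L (cong_lattice n p) \<sigma>" and p: "prime p" and n: "16 < n" "2 * p < n"
    and L: "\<not> represents L (cubic_lattice n)"
    and y: "y \<in> V" "B y y = 1" and x: "x \<in> lvecs (cong_lattice n 0)"
  shows "B y (\<sigma> x) = 0"
proof -
  obtain c where c: "c \<in> int_vecs n" "dot n c c \<le> 1"
    and prod: "\<And>x. x \<in> lvecs (cong_lattice n 0) \<Longrightarrow> B y (\<sigma> x) = dot n c x"
    using short_vector_products[OF \<sigma> n(1) y(1)] y(2) by auto
  have "dot n c c \<noteq> 1"
  proof
    assume 1: "dot n c c = 1"
    then have "\<bar>coord_sum n c\<bar> \<le> 1" "odd (coord_sum n c)"
      using abs_coord_sum_le[of n c] even_dot_iff[of n c] by auto
    then have "\<bar>coord_sum n c\<bar> = 1" by (cases "coord_sum n c = 0") auto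
    moreover have "\<not> int p dvd coord_sum n c"
      using p calculation by (auto simp: dvd_abs_iff[of "int p", symmetric] prime_gt_1_nat)
    ultimately show False
      using represents_cubic_if_root_products[OF \<sigma> p c(1) y(1) _ prod] L n y(2) 1 by simp
  qed
  then have "dot n c c = 0" using c(2) dot_nonneg[of n c] by linarith
  then have "\<forall>i<n. c i = 0" by (simp only: dot_eq_0_iff)
  then have "dot n c x = 0" by (simp add: dot_def)
  then show ?thesis using prod[OF x] by simp
qed

text \<open>Norm 2 with coordinate sum 2 or -2 is excluded because an odd \<open>p\<close> does not
  divide the sum and \<open>4 * p < n\<close> is the smallness condition. Smaller norms remain
  possible, as the extension criterion asks for the norm of \<open>y\<close>.\<close>

lemma root_products:
  assumes \<sigma>: "rep L (cong_lattice n p) \<sigma>" and p: "prime p" "odd p" and n: "16 < n" "4 * p < n"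
    and L: "\<not> represents L (cubic_lattice n)"
    and y: "y \<in> V" "B y y = 2"
  obtains c where "c \<in> int_vecs n" "dot n c c \<le> 1 \<or> dot n c c = 2 \<and> coord_sum n c = 0"
    "\<And>x. x \<in> lvecs (cong_lattice n 0) \<Longrightarrow> B y (\<sigma> x) = dot n c x"
proof -
  obtain c where c: "c \<in> int_vecs n" "dot n c c \<le> 2"
    and prod: "\<And>x. x \<in> lvecs (cong_lattice n 0) \<Longrightarrow> B y (\<sigma> x) = dot n c x"
    using short_vector_products[OF \<sigma> n(1) y(1)] y(2) by auto
  have "coord_sum n c = 0" if 2: "dot n c c = 2"
  proof (rule ccontr)
    assume "coord_sum n c \<noteq> 0"
    moreover have "\<bar>coord_sum n c\<bar> \<le> 2" "even (coord_sum n c)"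
      using 2 abs_coord_sum_le[of n c] even_dot_iff[of n c] by auto
    ultimately have m: "\<bar>coord_sum n c\<bar> = 2"
      by (cases "\<bar>coord_sum n c\<bar> = 1") auto
    have "\<not> int p dvd 2"
    proof
      assume "int p dvd 2"
      then have "p dvd 2" by (metis int_dvd_int_iff of_nat_numeral)
      then have "p \<le> 2" by (rule dvd_imp_le) simp
      then show False using p prime_gt_1_nat[of p] by (cases "p = 2") auto
    qed
    then have "\<not> int p dvd coord_sum n c" using m by (metis dvd_abs_iff)
    then show False
      using represents_cubic_if_root_products[OF \<sigma> p(1) c(1) y(1) _ prod] L n y(2) 2 m by simp
  qed
  then show thesis using that[OF c(1) _ prod] c(2) by force
qed

text \<open>The image of q e_0 under \<open>\<tau>\<close> has the products with the common root
  lattice that an image under \<open>\<sigma>\<close> would have, and \<open>2 * p * q < n\<close>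
  is the smallness condition for its coordinate sum \<open>q\<close>.\<close>

lemma represents_cubic_if_agree:
  assumes \<sigma>: "rep L (cong_lattice n p) \<sigma>" and \<tau>: "rep L (cong_lattice n q) \<tau>"
    and p: "prime p" and q: "prime q" and pq: "p \<noteq> q" "2 * p * q < n"
    and agree: "\<And>x. x \<in> lvecs (cong_lattice n 0) \<Longrightarrow> \<sigma> x = \<tau> x"
  shows "represents L (cubic_lattice n)"
proof -
  have n: "0 < n" using pq by simp
  define c where "c = zmul (int q) (unit_vec 0)"
  have c: "c \<in> int_vecs n" "coord_sum n c = int q" using n by (simp_all add: c_def)
  then have c': "c \<in> lvecs (cong_lattice n q)" by simp
  show ?thesis
  proof (rule represents_cubic_if_root_products[OF \<sigma> p c(1) rep_mem[OF \<tau> c']])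
    show "B (\<tau> c) (\<tau> c) = dot n c c" by (rule rep_dot[OF \<tau> c' c'])
    show "B (\<tau> c) (\<sigma> x) = dot n c x" if x: "x \<in> lvecs (cong_lattice n 0)" for x
      using agree[OF x] rep_dot[OF \<tau> c', of x] x by simp
    show "\<not> int p dvd coord_sum n c"
      using primes_dvd_imp_eq[OF p q] pq by (auto simp: c)
    show "2 * int p * \<bar>coord_sum n c\<bar> < int n"
      using pq(2) by (simp add: c) (metis of_nat_less_iff of_nat_mult of_nat_numeral)
  qed
qed

end

subsection \<open>Orthogonality of the root lattices\<close>

text \<open>For 0 < i < n these form a basis of the root lattice in which distinct members have
  product 1, and permutations of the coordinates other than 0 permute it.\<close>

abbreviation root_vec :: "nat \<Rightarrow> nat \<Rightarrow> int" where
  "root_vec i \<equiv> unit_vec 0 - unit_vec i"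

lemma root_mem: "i < n \<Longrightarrow> root_vec i \<in> lvecs (cong_lattice n p)"
  by simp

lemma dot_root: "0 < i \<Longrightarrow> 0 < j \<Longrightarrow> i < n \<Longrightarrow> j < n \<Longrightarrow>
    dot n (root_vec i) (root_vec j) = (if i = j then 2 else 1)"
  by simp (simp add: unit_vec_def)

context pos_lattice
begin

text \<open>Two roots with inner product 1 are exchanged by the reflection in their difference.\<close>

lemma extend_agreement:
  assumes \<sigma>: "rep L (cong_lattice n p) \<sigma>" and \<tau>: "rep L (cong_lattice n q) \<tau>"
    and agree: "\<And>i. 0 < i \<Longrightarrow> i \<le> k \<Longrightarrow> \<sigma> (root_vec i) = \<tau> (root_vec i)" and k: "Suc k < n"
    and pos: "0 < B (\<sigma> (root_vec (Suc k))) (\<tau> (root_vec (Suc k)))"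
  obtains \<tau>' where "rep L (cong_lattice n q) \<tau>'"
    "\<And>i. 0 < i \<Longrightarrow> i \<le> Suc k \<Longrightarrow> \<sigma> (root_vec i) = \<tau>' (root_vec i)"
proof -
  define r s where "r = \<sigma> (root_vec (Suc k))" and "s = \<tau> (root_vec (Suc k))"
  have rs: "r \<in> V" "s \<in> V"
    unfolding r_def s_def by (rule rep_mem[OF \<sigma> root_mem[OF k]] rep_mem[OF \<tau> root_mem[OF k]])+
  have norm: "B r r = 2" "B s s = 2"
    unfolding r_def s_def rep_dot[OF \<sigma> root_mem[OF k] root_mem[OF k]]
      rep_dot[OF \<tau> root_mem[OF k] root_mem[OF k]] using k by (subst dot_root; simp)+
  have d: "B (s - r) (s - r) = 4 - 2 * B r s"
    using rs norm sym[of s r] by simp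
  \<comment> \<open>Cauchy-Schwarz for norm 2: a positive integral product is 1 or 2, and 2 forces
    \<open>s = r\<close>.\<close>
  then have "B r s \<le> 2" using form_nonneg[of "s - r"] rs by simp
  then consider "B r s = 2" | "B r s = 1" using pos unfolding r_def s_def by linarith
  then show thesis
  proof cases
    case 1
    then have "s = r" using d form_eq_0[of "s - r"] rs by simp
    then show thesis
      using that[OF \<tau>] agree by (metis le_Suc_eq r_def s_def)
  next
    case 2
    then have d2: "B (s - r) (s - r) = 2" using d by simp
    have "\<sigma> (root_vec i) = refl (s - r) (\<tau> (root_vec i))" if i: "0 < i" "i \<le> Suc k" for i
    proof (cases "i = Suc k")
      case True
      have "B s (s - r) = 1" using rs norm 2 sym[of s r] by simp
      then show ?thesis using True by (simp add: refl_def zmul_1 flip: r_def s_def)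
    next
      case False
      then have i': "i < n" "i \<le> k" using i k by auto
      have t: "\<tau> (root_vec i) \<in> V" by (rule rep_mem[OF \<tau> root_mem[OF i'(1)]])
      \<comment> \<open>\<open>\<sigma>\<close> and \<open>\<tau>\<close> agree on
        \<open>root_vec i\<close>, so both sides are its product with
        \<open>root_vec (Suc k)\<close>. Thus the reflection fixes the roots matched so far.\<close>
      have "B (\<tau> (root_vec i)) s = B (\<tau> (root_vec i)) r"
        unfolding s_def using rep_dot[OF \<tau> root_mem[OF i'(1)] root_mem[OF k]]
          rep_dot[OF \<sigma> root_mem[OF i'(1)] root_mem[OF k]] agree[OF i(1) i'(2)]
        by (simp only: r_def)
      then have "B (\<tau> (root_vec i)) (s - r) = 0" using t rs by simp
      then show ?thesis using agree[OF i(1) i'(2)] by (simp add: refl_def)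
    qed
    then show thesis
      using that[OF rep_comp[OF rep_refl[OF _ d2] \<tau>]] rs by simp
  qed
qed

text \<open>Otherwise the vector \<open>c\<close> giving the products of
  \<open>\<tau> (root_vec j)\<close> with the roots of \<open>\<sigma>\<close> has c_0 = c_1 + 1,
  c_2 = c_1 and c_j >= c_0. Norm at most 2 leaves only norm 2 with coordinate sum 2 or -2, which
  \<open>root_products\<close> excludes. With a single matched root, e_j - e_1 would
  survive.\<close>

lemma root_agreement_pos:
  assumes \<sigma>: "rep L (cong_lattice n p) \<sigma>" and \<tau>: "rep L (cong_lattice n q) \<tau>"
    and p: "prime p" "odd p" and n: "16 < n" "4 * p < n"
    and L: "\<not> represents L (cubic_lattice n)"
    and agree: "\<sigma> (root_vec 1) = \<tau> (root_vec 1)" "\<sigma> (root_vec 2) = \<tau> (root_vec 2)"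
    and j: "2 < j" "j < n"
  shows "0 < B (\<sigma> (root_vec j)) (\<tau> (root_vec j))"
proof (rule ccontr)
  assume neg: "\<not> ?thesis"
  have mem: "root_vec 1 \<in> lvecs (cong_lattice n r)" "root_vec 2 \<in> lvecs (cong_lattice n r)"
    "root_vec j \<in> lvecs (cong_lattice n r)" for r
    using n j root_mem by auto
  define y where "y = \<tau> (root_vec j)"
  have y: "y \<in> V" "B y y = 2"
    using rep_mem[OF \<tau> mem(3)] rep_dot[OF \<tau> mem(3) mem(3)] j dot_root[of j j n] by (simp_all add: y_def)
  obtain c where c: "dot n c c \<le> 1 \<or> dot n c c = 2 \<and> coord_sum n c = 0"
    and prod: "\<And>x. x \<in> lvecs (cong_lattice n 0) \<Longrightarrow> B y (\<sigma> x) = dot n c x"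
    using root_products[OF \<sigma> p n L y] by metis
  have "B y (\<sigma> (root_vec 1)) = 1" "B y (\<sigma> (root_vec 2)) = 1"
    unfolding agree y_def rep_dot[OF \<tau> mem(3) mem(1)] rep_dot[OF \<tau> mem(3) mem(2)]
    using j n dot_root[of j 1 n] dot_root[of j 2 n] by simp_all
  then have c12: "c 0 = c 1 + 1" "c 2 = c 1"
    using prod[OF mem(1)] prod[OF mem(2)] n by simp_all
  have "B y (\<sigma> (root_vec j)) \<le> 0"
    using neg sym[OF y(1) rep_mem[OF \<sigma> mem(3)]] by (simp add: y_def)
  then have cj: "c 0 \<le> c j" using prod[OF mem(3)] n j by simp
  \<comment> \<open>The four constrained coordinates. Outside \<open>F\<close> the norm bounds the
    absolute coordinate sum, so once \<open>F\<close> accounts for norm 2 the remaining sum is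
    0.\<close>
  define F where "F = {0, 1, 2, j}"
  have F: "F \<subseteq> {..<n}" "finite F" using n j by (auto simp: F_def)
  have sumF: "(\<Sum>i\<in>F. g i) = g 0 + g 1 + g 2 + g j" for g :: "nat \<Rightarrow> int"
    using j by (simp add: F_def)
  have split: "dot n c c = (\<Sum>i\<in>F. c i * c i) + (\<Sum>i\<in>{..<n} - F. c i * c i)"
    "coord_sum n c = (\<Sum>i\<in>F. c i) + (\<Sum>i\<in>{..<n} - F. c i)"
    unfolding dot_def coord_sum_def using F by (simp_all add: sum.subset_diff add.commute)
  have rest: "\<bar>\<Sum>i\<in>{..<n} - F. c i\<bar> \<le> (\<Sum>i\<in>{..<n} - F. c i * c i)"
    by (rule abs_sum_le_sum_squares)
  moreover have rest0: "0 \<le> (\<Sum>i\<in>{..<n} - F. c i * c i)" by (simp add: sum_nonneg)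
  ultimately have le: "c 0 * c 0 + c 1 * c 1 + c 1 * c 1 + c j * c j \<le> 2"
    using c split(1) unfolding sumF c12(2) by linarith
  have sq: "0 \<le> c 0 * c 0" "0 \<le> c 1 * c 1" "0 \<le> c j * c j" by simp_all
  have "c 1 * c 1 \<le> 1" using le sq by linarith
  then have "\<bar>c 1\<bar> \<le> 1" by (metis abs_le_square_iff abs_one power2_eq_square mult_1)
  then consider "c 1 = 0" | "c 1 = - 1" | "c 1 = 1" by linarith
  then show False
  proof cases
    case 1
    then have "c 0 = 1" "1 \<le> c j" using c12 cj by simp_all
    moreover have "1 * c j \<le> c j * c j" using \<open>1 \<le> c j\<close> by (intro mult_right_mono) auto
    then have "c j \<le> 1" using le 1 \<open>c 0 = 1\<close> unfolding \<open>c 0 = 1\<close> 1 by linarith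
    then have "c j = 1" using \<open>1 \<le> c j\<close> by simp
    then show False using c split rest rest0 \<open>c 0 = 1\<close> 1 unfolding sumF c12(2) by auto
  next
    case 2
    then have "c 0 = 0" using c12 by simp
    then have "c j * c j = 0" using le sq unfolding \<open>c 0 = 0\<close> 2 by linarith
    then have "c j = 0" by simp
    then show False using c split rest rest0 \<open>c 0 = 0\<close> 2 unfolding sumF c12(2) by auto
  next
    case 3
    then show False using le c12 sq by simp
  qed
qed

text \<open>If the product were nonzero, signs, permutations and reflections would change
  \<open>\<tau>\<close>, one root at a time, until it agrees with \<open>\<sigma>\<close> on the
  whole root lattice, and then \<open>represents_cubic_if_agree\<close> applies.\<close>

lemma first_roots_orth:
  assumes \<sigma>: "rep L (cong_lattice n p) \<sigma>" and \<tau>: "rep L (cong_lattice n q) \<tau>"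
    and p: "prime p" "odd p" and q: "prime q" and pq: "p \<noteq> q" "2 * p * q < n"
    and n: "16 < n" "4 * p < n"
    and L: "\<not> represents L (cubic_lattice n)"
  shows "B (\<sigma> (root_vec 1)) (\<tau> (root_vec 1)) = 0"
proof (rule ccontr)
  assume nz: "B (\<sigma> (root_vec 1)) (\<tau> (root_vec 1)) \<noteq> 0"
  have mem: "root_vec 1 \<in> lvecs (cong_lattice n r)" "root_vec 2 \<in> lvecs (cong_lattice n r)" for r
    using n root_mem by auto
  note s = rep_mem[OF \<sigma> mem(1)] rep_mem[OF \<sigma> mem(2)]
  obtain \<tau>1 where \<tau>1: "rep L (cong_lattice n q) \<tau>1"
    and pos: "0 < B (\<sigma> (root_vec 1)) (\<tau>1 (root_vec 1))"
  proof (cases "0 < B (\<sigma> (root_vec 1)) (\<tau> (root_vec 1))")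
    case True
    then show thesis using that[OF \<tau>] by simp
  next
    case False
    then show thesis
      using that[OF rep_comp[OF rep_uminus \<tau>]] nz rep_mem[OF \<tau> mem(1)] s by simp
  qed
  obtain \<tau>2 where \<tau>2: "rep L (cong_lattice n q) \<tau>2" and agree1: "\<sigma> (root_vec 1) = \<tau>2 (root_vec 1)"
    using extend_agreement[OF \<sigma> \<tau>1, of 0] pos n by auto
  have "\<exists>\<tau>. rep L (cong_lattice n q) \<tau> \<and> \<sigma> (root_vec 1) = \<tau> (root_vec 1) \<and> 0 < B (\<sigma> (root_vec 2)) (\<tau> (root_vec 2))"
  proof (cases "0 < B (\<sigma> (root_vec 2)) (\<tau>2 (root_vec 2))")
    case True
    then show ?thesis using \<tau>2 agree1 by blast
  next
    case False
    \<comment> \<open>Swapping coordinates 0 and 1 with a sign fixes e_0 - e_1 and maps e_0 - e_2 to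
      e_2 - e_1. This turns a product b <= 0 for the second root into 1 - b > 0.\<close>
    define \<tau>3 where "\<tau>3 x = - \<tau>2 (x \<circ> transpose 0 1)" for x
    have "rep L (cong_lattice n q) \<tau>3"
      unfolding \<tau>3_def
      using n by (intro rep_comp[OF rep_uminus rep_comp[OF \<tau>2 rep_permute]] permutes_swap_id) auto
    moreover have "root_vec 1 \<circ> transpose 0 1 = - root_vec 1" "root_vec 2 \<circ> transpose 0 1 = root_vec 2 - root_vec 1"
      using unit_vec_transpose[of _ 0 1] by (auto simp: fun_eq_iff unit_vec_def transpose_def)
    then have \<tau>3: "\<tau>3 (root_vec 1) = \<tau>2 (root_vec 1)" "\<tau>3 (root_vec 2) = \<tau>2 (root_vec 1) - \<tau>2 (root_vec 2)"
      unfolding \<tau>3_def using rep_linear(2)[OF \<tau>2 mem(1)] rep_linear(4)[OF \<tau>2 mem(2) mem(1)]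
      by simp_all
    moreover have "B (\<sigma> (root_vec 2)) (\<tau>2 (root_vec 1)) = 1"
      unfolding agree1[symmetric] rep_dot[OF \<sigma> mem(2) mem(1)] using n dot_root[of 2 1 n] by simp
    ultimately show ?thesis
      using False agree1 s rep_mem[OF \<tau>2 mem(1)] rep_mem[OF \<tau>2 mem(2)]
      by (intro exI[of _ \<tau>3]) simp
  qed
  then obtain \<tau>4 where \<tau>4: "rep L (cong_lattice n q) \<tau>4" "\<sigma> (root_vec 1) = \<tau>4 (root_vec 1)"
    "0 < B (\<sigma> (root_vec 2)) (\<tau>4 (root_vec 2))" by blast
  \<comment> \<open>The first two roots were prepared by hand; from the third on,
    \<open>root_agreement_pos\<close> supplies the positivity that \<open>extend_agreement\<close>
    asks for.\<close>
  have ex: "\<exists>\<tau>. rep L (cong_lattice n q) \<tau> \<and> (\<forall>i. 0 < i \<and> i \<le> k \<longrightarrow> \<sigma> (root_vec i) = \<tau> (root_vec i))"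
    if "2 \<le> k" "k < n" for k
    using that
  proof (induction k rule: dec_induct)
    case base
    have "\<sigma> (root_vec i) = \<tau>4 (root_vec i)" if "0 < i" "i \<le> 1" for i
      using that \<tau>4(2) by (cases "i = 1") auto
    then obtain \<tau>' where "rep L (cong_lattice n q) \<tau>'"
      "\<And>i. 0 < i \<Longrightarrow> i \<le> Suc 1 \<Longrightarrow> \<sigma> (root_vec i) = \<tau>' (root_vec i)"
      using extend_agreement[OF \<sigma> \<tau>4(1), of 1] \<tau>4(3) n by (auto simp: numeral_2_eq_2)
    then show ?case unfolding numeral_2_eq_2 One_nat_def by blast
  next
    case (step k)
    then obtain \<tau>' where \<tau>': "rep L (cong_lattice n q) \<tau>'"
      and agree: "\<And>i. 0 < i \<Longrightarrow> i \<le> k \<Longrightarrow> \<sigma> (root_vec i) = \<tau>' (root_vec i)"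
      using Suc_lessD by blast
    have "0 < B (\<sigma> (root_vec (Suc k))) (\<tau>' (root_vec (Suc k)))"
      using root_agreement_pos[OF \<sigma> \<tau>' p n L] agree step by simp
    then show ?case using extend_agreement[OF \<sigma> \<tau>' agree] step by metis
  qed
  obtain \<tau>5 where \<tau>5: "rep L (cong_lattice n q) \<tau>5"
    and agree: "\<And>i. 0 < i \<Longrightarrow> i < n \<Longrightarrow> \<sigma> (root_vec i) = \<tau>5 (root_vec i)"
    using ex[of "n - 1"] n by fastforce
  have "\<sigma> x = \<tau>5 x" if x: "x \<in> lvecs (cong_lattice n 0)" for x
  proof -
    have m: "- root_vec i \<in> lvecs (cong_lattice n r)" if "i < n" for i r
      using that by simp
    have "h x = (\<Sum>i<n. zmul (x i) (h (- root_vec i)))"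
      if h: "rep L (cong_lattice n r) h" for h r
    proof -
      note add = rep_additive[OF h subspace_cong_lattice]
      have "h x = h (\<Sum>i<n. zmul (x i) (- root_vec i))"
        using root_decomp[OF x] by simp
      also have "\<dots> = (\<Sum>i<n. h (zmul (x i) (- root_vec i)))"
        by (rule additive_on_sum[OF add]) (use m in \<open>auto simp: dvd_mult\<close>)
      also have "\<dots> = (\<Sum>i<n. zmul (x i) (h (- root_vec i)))"
        using m by (intro sum.cong refl additive_on_zmul[OF add]) auto
      finally show ?thesis .
    qed
    note this[OF \<sigma>] this[OF \<tau>5]
    moreover have "\<sigma> (- root_vec i) = \<tau>5 (- root_vec i)" if "i < n" for i
      using agree[of i] that rep_linear(2)[OF \<sigma> root_mem[OF that]]
        rep_linear(2)[OF \<tau>5 root_mem[OF that]] additive_on_0[OF rep_additive[OF \<sigma> subspace_cong_lattice]]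
        additive_on_0[OF rep_additive[OF \<tau>5 subspace_cong_lattice]]
      by (cases "i = 0") (auto simp del: minus_diff_eq)
    ultimately show ?thesis by simp
  qed
  then show False
    using represents_cubic_if_agree[OF \<sigma> \<tau>5 p(1) q pq] L by blast
qed

text \<open>Transpositions carry \<open>first_roots_orth\<close> to all pairs e_0 - e_i, e_0 - e_j,
  and these roots generate. The case \<open>q = 2\<close> is included and later serves for
  \<open>D_lattice\<close>.\<close>

lemma root_lattices_orth:
  assumes \<sigma>: "rep L (cong_lattice n p) \<sigma>" and \<tau>: "rep L (cong_lattice n q) \<tau>"
    and p: "prime p" "odd p" and q: "prime q" and pq: "p \<noteq> q" "2 * p\<^sup>2 < n" "2 * q\<^sup>2 < n"
    and L: "\<not> represents L (cubic_lattice n)"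
    and x: "x \<in> lvecs (cong_lattice n 0)" and y: "y \<in> lvecs (cong_lattice n 0)"
  shows "B (\<sigma> x) (\<tau> y) = 0"
proof -
  \<comment> \<open>An odd prime is at least 3, so n > 2 p^2 >= 18 and 2 p^2 >= 6 p; this yields
    both bounds in \<open>n\<close>.\<close>
  have p3: "3 \<le> p" using p prime_gt_1_nat[of p] by (cases "p = 2") auto
  have pp: "3 * p \<le> p * p" using p3 by (intro mult_right_mono) auto
  then have n: "16 < n" "4 * p < n" using pq p3 unfolding power2_eq_square by linarith+
  have pq': "2 * p * q < n"
  proof (cases "p \<le> q")
    case True
    then have "p * q \<le> q * q" by (rule mult_right_mono) simp
    then show ?thesis using pq unfolding power2_eq_square by linarith
  next
    case False
    then have "p * q \<le> p * p" by (intro mult_left_mono) simp_all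
    then show ?thesis using pq unfolding power2_eq_square by linarith
  qed
  have root: "B (\<sigma> (root_vec i)) (\<tau> (root_vec j)) = 0" if ij: "0 < i" "i < n" "0 < j" "j < n" for i j
  proof -
    have tr: "root_vec 1 \<circ> transpose 1 k = root_vec k" if "0 < k" for k
      using that by (auto simp: fun_eq_iff unit_vec_def transpose_def)
    have "rep L (cong_lattice n p) (\<lambda>x. \<sigma> (x \<circ> transpose 1 i))"
      "rep L (cong_lattice n q) (\<lambda>x. \<tau> (x \<circ> transpose 1 j))"
      using n ij by (intro rep_comp[OF \<sigma> rep_permute] rep_comp[OF \<tau> rep_permute] permutes_swap_id; simp)+
    from first_roots_orth[OF this p q pq(1) pq' n L] show ?thesis
      unfolding tr[OF ij(1)] tr[OF ij(3)] .
  qed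
  have neg: "h (unit_vec i - unit_vec 0) = - h (root_vec i)"
    if "rep L (cong_lattice n r) h" "i < n" for h r i
    using rep_linear(2)[OF that(1) root_mem[OF that(2)]] by simp
  have 0: "h 0 = 0" if "rep L (cong_lattice n r) h" for h r
    using additive_on_0[OF rep_additive[OF that subspace_cong_lattice]] .
  have root': "B (\<sigma> (unit_vec i - unit_vec 0)) (\<tau> (unit_vec j - unit_vec 0)) = 0"
    if ij: "i < n" "j < n" for i j
  proof (cases "i = 0 \<or> j = 0")
    case True
    then show ?thesis
      using ij 0[OF \<sigma>] 0[OF \<tau>] rep_mem[OF \<sigma>, of "unit_vec i - unit_vec 0"]
        rep_mem[OF \<tau>, of "unit_vec j - unit_vec 0"] by auto
  next
    case False
    then show ?thesis
      using ij root[of i j] rep_mem[OF \<sigma> root_mem] rep_mem[OF \<tau> root_mem]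
      by (simp add: neg[OF \<sigma>] neg[OF \<tau>])
  qed
  have n0: "0 < n" using n by simp
  have xm: "\<sigma> x \<in> V" "\<tau> y \<in> V"
    using rep_mem[OF \<sigma>, of x] rep_mem[OF \<tau>, of y] x y by auto
  have "B (\<tau> (unit_vec j - unit_vec 0)) (\<sigma> x) = 0" if j: "j < n" for j
  proof -
    have t: "\<tau> (unit_vec j - unit_vec 0) \<in> V" using j n0 by (intro rep_mem[OF \<tau>]) simp
    have "B (\<tau> (unit_vec j - unit_vec 0)) (\<sigma> (unit_vec i - unit_vec 0)) = 0" if "i < n" for i
      using root'[OF that j] sym[OF t rep_mem[OF \<sigma>, of "unit_vec i - unit_vec 0"]] that n0 by simp
    then show ?thesis using root_additive_dot[OF \<sigma> x n0 t] by simp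
  qed
  then have "B (\<sigma> x) (\<tau> (unit_vec j - unit_vec 0)) = 0" if "j < n" for j
    using sym[OF xm(1) rep_mem[OF \<tau>, of "unit_vec j - unit_vec 0"]] that n0 by simp
  then show ?thesis using root_additive_dot[OF \<tau> y n0 xm(1)] by simp
qed

end

subsection \<open>Rank and the even sublattice\<close>

text \<open>Gaussian elimination over the integers, with cross-multiplication by the pivot in place
  of division.\<close>

lemma homogeneous_system_solution:
  fixes a :: "'i \<Rightarrow> 'j \<Rightarrow> int"
  assumes "finite J" "finite I" "card J < card I"
  shows "\<exists>c. (\<exists>i\<in>I. c i \<noteq> 0) \<and> (\<forall>j\<in>J. (\<Sum>i\<in>I. c i * a i j) = 0)"
  using assms
proof (induction J arbitrary: I a)
  case empty
  then show ?case by (intro exI[of _ "\<lambda>_. 1"]) (auto simp: card_gt_0_iff)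
next
  case (insert j J)
  show ?case
  proof (cases "\<forall>i\<in>I. a i j = 0")
    case True
    from insert obtain c where "\<exists>i\<in>I. c i \<noteq> 0" "\<forall>j\<in>J. (\<Sum>i\<in>I. c i * a i j) = 0"
      using insert.IH[of I a] by (metis Suc_lessD card_insert_disjoint)
    with True show ?thesis by (intro exI[of _ c]) auto
  next
    case False
    then obtain i0 where i0: "i0 \<in> I" "a i0 j \<noteq> 0" by auto
    define I' where "I' = I - {i0}"
    have I': "finite I'" "card J < card I'" "I = insert i0 I'" "i0 \<notin> I'"
      using insert i0 by (auto simp: I'_def)
    obtain c where c: "\<exists>i\<in>I'. c i \<noteq> 0"
      "\<forall>l\<in>J. (\<Sum>i\<in>I'. c i * (a i0 j * a i l - a i j * a i0 l)) = 0"
      using insert.IH[OF I'(1,2), of "\<lambda>i l. a i0 j * a i l - a i j * a i0 l"] by blast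
    \<comment> \<open>Scaling by the nonzero pivot keeps the solution nontrivial; the entry at
      \<open>i0\<close> is chosen to solve equation \<open>j\<close>.\<close>
    define d where "d i = (if i = i0 then - (\<Sum>i\<in>I'. c i * a i j) else a i0 j * c i)" for i
    have d: "(\<Sum>i\<in>I. d i * a i l) = (\<Sum>i\<in>I'. c i * (a i0 j * a i l - a i j * a i0 l))" for l
    proof -
      have "(\<Sum>i\<in>I'. d i * a i l) = (\<Sum>i\<in>I'. a i0 j * c i * a i l)"
        using I'(4) by (intro sum.cong) (auto simp: d_def)
      then have "(\<Sum>i\<in>I. d i * a i l) =
          (\<Sum>i\<in>I'. a i0 j * c i * a i l) - (\<Sum>i\<in>I'. c i * a i j) * a i0 l"
        using I' by (simp add: d_def)
      then show ?thesis
        by (simp only: sum_distrib_right sum_subtractf[symmetric]) (intro sum.cong refl, simp add: algebra_simps)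
    qed
    have "\<exists>i\<in>I. d i \<noteq> 0"
      using c(1) i0(2) I' by (auto simp: d_def)
    moreover have "(\<Sum>i\<in>I. d i * a i l) = 0" if "l \<in> insert j J" for l
      using that c(2) unfolding d by auto
    ultimately show ?thesis by blast
  qed
qed

text \<open>More vectors than generators satisfy a nontrivial integral relation; pairing it with a
  vector whose coefficient is nonzero isolates that coefficient times a nonzero norm.\<close>

lemma (in pos_lattice) orthogonal_card_le:
  assumes I: "finite I" and X: "finite X" "X \<subseteq> V"
    and span: "\<And>i. i \<in> I \<Longrightarrow> v i \<in> zmod.span X"
    and orth: "\<And>i j. i \<in> I \<Longrightarrow> j \<in> I \<Longrightarrow> i \<noteq> j \<Longrightarrow> B (v i) (v j) = 0"
    and pos: "\<And>i. i \<in> I \<Longrightarrow> B (v i) (v i) \<noteq> 0"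
  shows "card I \<le> card X"
proof (rule ccontr)
  assume "\<not> ?thesis"
  then have less: "card X < card I" by simp
  have "\<forall>i\<in>I. \<exists>u. v i = (\<Sum>x\<in>X. zmul (u x) x)"
    using span by (auto simp: zmod.span_finite[OF X(1)])
  then obtain a where a: "\<And>i. i \<in> I \<Longrightarrow> v i = (\<Sum>x\<in>X. zmul (a i x) x)"
    by metis
  obtain c where c: "\<exists>i\<in>I. c i \<noteq> 0" "\<forall>x\<in>X. (\<Sum>i\<in>I. c i * a i x) = 0"
    using homogeneous_system_solution[OF X(1) I less] by blast
  have "(\<Sum>i\<in>I. zmul (c i) (v i)) = (\<Sum>i\<in>I. \<Sum>x\<in>X. zmul (c i * a i x) x)"
    by (intro sum.cong refl) (simp add: a zmod.scale_sum_right zmul_zmul)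
  also have "\<dots> = (\<Sum>x\<in>X. zmul (\<Sum>i\<in>I. c i * a i x) x)"
    by (subst sum.swap) (simp add: zmod.scale_sum_left)
  also have "\<dots> = 0" using c(2) by simp
  finally have 0: "(\<Sum>i\<in>I. zmul (c i) (v i)) = 0" .
  have mem_v: "v i \<in> V" if "i \<in> I" for i
    using span[OF that] zmod.span_minimal[OF X(2) subspace] by blast
  obtain k where k: "k \<in> I" "c k \<noteq> 0" using c(1) by blast
  have "0 = B (\<Sum>i\<in>I. zmul (c i) (v i)) (v k)"
    using mem_v[OF k(1)] by (simp add: 0)
  also have "\<dots> = (\<Sum>i\<in>I. B (zmul (c i) (v i)) (v k))"
    using mem_v k by (intro form_sum_left I) auto
  also have "\<dots> = (\<Sum>i\<in>I. if i = k then c k * B (v k) (v k) else 0)"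
    using mem_v k orth by (intro sum.cong) auto
  also have "\<dots> = c k * B (v k) (v k)"
    using I k by simp
  finally show False using k pos[of k] by simp
qed

text \<open>Changing the sign of one coordinate changes the coordinate sum by an even number. This
  isometry of \<open>D_lattice\<close> turns e_i - e_k into e_i + e_k.\<close>

lemma rep_flip: "k < n \<Longrightarrow> rep (cong_lattice n 2) (cong_lattice n 2) (\<lambda>x. x - zmul (2 * x k) (unit_vec k))"
  by (auto simp: rep_def lquad_def zmul_add_left algebra_simps unit_vec_def[of k, THEN fun_cong])

section \<open>Orthogonality of \<open>D_lattice\<close> and the smaller cubic lattice\<close>

context pos_lattice
begin

text \<open>Twice \<open>y\<close> is an integral combination of the vectors 2 e_i, which lie in
  \<open>D_lattice\<close> although e_i does not; the factor 2 then cancels.\<close>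

lemma orth_D_lattice:
  assumes \<sigma>: "rep L (cong_lattice n 2) \<sigma>" and z: "z \<in> V"
    and orth: "\<And>i. i < n \<Longrightarrow> B z (\<sigma> (zmul 2 (unit_vec i))) = 0"
    and y: "y \<in> lvecs (cong_lattice n 2)"
  shows "B z (\<sigma> y) = 0"
proof -
  have m: "zmul 2 (unit_vec i) \<in> lvecs (cong_lattice n 2)" if "i < n" for i
    using that by simp
  have m': "zmul (y i) (zmul 2 (unit_vec i)) \<in> lvecs (cong_lattice n 2)" if "i < n" for i
    using m[OF that] subspace_cong_lattice zmod.subspace_scale by blast
  note add = rep_additive[OF \<sigma> subspace_cong_lattice]
  have "zmul 2 y = zmul 2 (\<Sum>i<n. zmul (y i) (unit_vec i))"
    using y int_vecs_decomp[of y n] by simp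
  also have "\<dots> = (\<Sum>i<n. zmul (y i) (zmul 2 (unit_vec i)))"
    by (simp add: zmod.scale_sum_right mult.commute)
  finally have "zmul 2 (\<sigma> y) = \<sigma> (\<Sum>i<n. zmul (y i) (zmul 2 (unit_vec i)))"
    using rep_linear(1)[OF \<sigma> y, of 2] by simp
  also have "\<dots> = (\<Sum>i<n. \<sigma> (zmul (y i) (zmul 2 (unit_vec i))))"
    by (rule additive_on_sum[OF add]) (use m' in auto)
  also have "\<dots> = (\<Sum>i<n. zmul (y i) (\<sigma> (zmul 2 (unit_vec i))))"
    using m by (intro sum.cong refl additive_on_zmul[OF add]) auto
  finally have "2 * B z (\<sigma> y) = B z (\<Sum>i<n. zmul (y i) (\<sigma> (zmul 2 (unit_vec i))))"
    using z rep_mem[OF \<sigma> y] by (metis form_right(5))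
  also have "\<dots> = (\<Sum>i<n. B z (zmul (y i) (\<sigma> (zmul 2 (unit_vec i)))))"
    using rep_mem[OF \<sigma> m] z by (intro form_sum_right) auto
  also have "\<dots> = 0"
    using rep_mem[OF \<sigma> m] z orth by (intro sum.neutral) auto
  finally show ?thesis by simp
qed

lemma orth_cubic:
  assumes \<phi>: "rep L (cong_lattice n 1) \<phi>" and z: "z \<in> V" and x: "x \<in> int_vecs n"
  shows "B z (\<phi> x) = (\<Sum>i<n. x i * B z (\<phi> (unit_vec i)))"
proof -
  have m: "zmul (x i) (unit_vec i) \<in> lvecs (cong_lattice n 1)"
    "unit_vec i \<in> lvecs (cong_lattice n 1)" if "i < n" for i
    using that by simp_all
  note add = rep_additive[OF \<phi> subspace_cong_lattice]
  have "\<phi> x = \<phi> (\<Sum>i<n. zmul (x i) (unit_vec i))"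
    using int_vecs_decomp[OF x] by simp
  also have "\<dots> = (\<Sum>i<n. \<phi> (zmul (x i) (unit_vec i)))"
    by (rule additive_on_sum[OF add]) (use m in auto)
  also have "\<dots> = (\<Sum>i<n. zmul (x i) (\<phi> (unit_vec i)))"
    using m by (intro sum.cong refl additive_on_zmul[OF add]) auto
  finally have "B z (\<phi> x) = B z (\<Sum>i<n. zmul (x i) (\<phi> (unit_vec i)))" by simp
  also have "\<dots> = (\<Sum>i<n. B z (zmul (x i) (\<phi> (unit_vec i))))"
    using rep_mem[OF \<phi> m(2)] z by (intro form_sum_right) auto
  also have "\<dots> = (\<Sum>i<n. x i * B z (\<phi> (unit_vec i)))"
    using rep_mem[OF \<phi> m(2)] z by (intro sum.cong) auto
  finally show ?thesis .
qed

lemma represents_cubic_Suc: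
  assumes \<phi>: "rep L (cong_lattice m 1) \<phi>" and g: "g \<in> V" "B g g = 1"
    and orth: "\<And>x. x \<in> int_vecs m \<Longrightarrow> B g (\<phi> x) = 0"
  shows "represents L (cubic_lattice (Suc m))"
proof -
  define r where "r x = x - zmul (x m) (unit_vec m)" for x :: "nat \<Rightarrow> int"
  have r: "r x \<in> int_vecs m" if "x \<in> int_vecs (Suc m)" for x
  proof -
    have "r x i = 0" if "m \<le> i" for i
      using that \<open>x \<in> int_vecs (Suc m)\<close> by (cases "i = m") (auto simp: r_def int_vecs_def unit_vec_def)
    then show ?thesis by (simp add: int_vecs_def)
  qed
  then have r': "r x \<in> lvecs (cong_lattice m 1)" if "x \<in> int_vecs (Suc m)" for x
    using that by simp
  have "rep L (cubic_lattice (Suc m)) (\<lambda>x. \<phi> (r x) + zmul (x m) g)"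
    unfolding rep_def
  proof (intro conjI ballI)
    fix x assume "x \<in> lvecs (cubic_lattice (Suc m))"
    then have x: "x \<in> int_vecs (Suc m)" by (simp add: cubic_lattice_def)
    note rx = rep_mem[OF \<phi> r'[OF x]]
    show "\<phi> (r x) + zmul (x m) g \<in> V" using rx g by simp
    have "lquad L (\<phi> (r x) + zmul (x m) g) = dot m (r x) (r x) + x m * x m"
      using rx g orth[OF r[OF x]] sym[OF rx g(1)] rep_dot[OF \<phi> r'[OF x] r'[OF x]]
      by (simp add: lquad_def)
    also have "dot m (r x) (r x) = (\<Sum>i<m. x i * x i)"
      by (simp add: dot_def r_def unit_vec_def)
    also have "\<dots> + x m * x m = lquad (cubic_lattice (Suc m)) x"
      by (simp add: lquad_def cubic_lattice_def dot_def)
    finally show "lquad L (\<phi> (r x) + zmul (x m) g) = lquad (cubic_lattice (Suc m)) x" .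
  next
    fix x y assume "x \<in> lvecs (cubic_lattice (Suc m))" "y \<in> lvecs (cubic_lattice (Suc m))"
    then have "x \<in> int_vecs (Suc m)" "y \<in> int_vecs (Suc m)" by (simp_all add: cubic_lattice_def)
    from rep_linear(3)[OF \<phi> r'[OF this(1)] r'[OF this(2)]]
    have "\<phi> (r (x + y)) = \<phi> (r x) + \<phi> (r y)"
      by (simp add: r_def algebra_simps zmul_add_left)
    then show "\<phi> (r (x + y)) + zmul ((x + y) m) g = \<phi> (r x) + zmul (x m) g + (\<phi> (r y) + zmul (y m) g)"
      by (simp add: zmul_add_left)
  qed
  then show ?thesis by (auto simp: represents_iff)
qed

text \<open>The cubic lattice is unimodular, so the projection of \<open>r\<close> to its image is
  an integral vector \<open>\<phi> u\<close>. The remainder \<open>z\<close> has norm 0, 1 or 2, and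
  norm 1 would extend \<open>\<phi>\<close> by \<open>represents_cubic_Suc\<close>.\<close>

lemma root_cubic_cases:
  assumes \<phi>: "rep L (cong_lattice m 1) \<phi>" and L: "\<not> represents L (cubic_lattice (Suc m))"
    and r: "r \<in> V" "B r r = 2"
  shows "(\<forall>x\<in>int_vecs m. B r (\<phi> x) = 0) \<or> (\<exists>u\<in>int_vecs m. r = \<phi> u)"
proof -
  define u where "u j = (if j < m then B r (\<phi> (unit_vec j)) else 0)" for j
  have u: "u \<in> int_vecs m" "u \<in> lvecs (cong_lattice m 1)" by (simp_all add: u_def int_vecs_def)
  note pu = rep_mem[OF \<phi> u(2)]
  have prod: "B r (\<phi> x) = dot m u x" if "x \<in> int_vecs m" for x
    using orth_cubic[OF \<phi> r(1) that] by (simp add: u_def dot_def mult.commute)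
  define z where "z = r - \<phi> u"
  have z: "z \<in> V" using r pu by (simp add: z_def)
  have zx: "B z (\<phi> x) = 0" if x: "x \<in> int_vecs m" for x
    using prod[OF x] rep_dot[OF \<phi> u(2), of x] rep_mem[OF \<phi>, of x] x r pu by (simp add: z_def)
  have "B z z = B z r - B z (\<phi> u)"
    using z r pu by (metis form_right(3) z_def)
  then have zz: "B z z = 2 - dot m u u"
    using zx[OF u(1)] r pu prod[OF u(1)] sym[OF r(1) pu] by (simp add: z_def)
  have "B z z \<noteq> 1" using represents_cubic_Suc[OF \<phi> z _ zx] L by blast
  then have "dot m u u = 0 \<or> B z z = 0"
    using zz form_nonneg[OF z] dot_nonneg[of m u] by linarith
  then show ?thesis
  proof
    assume "dot m u u = 0"
    then have "\<forall>i<m. u i = 0" by (simp only: dot_eq_0_iff)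
    then show ?thesis using prod by (simp add: dot_def)
  next
    assume "B z z = 0"
    then have "r = \<phi> u" using form_eq_0[OF z] by (simp add: z_def)
    then show ?thesis using u by blast
  qed
qed

text \<open>By \<open>root_cubic_cases\<close> each root of \<open>D\<^sub>n\<close> maps into \<open>I\<^sub>n\<^sub>-\<^sub>1\<close> or orthogonally to it. Since the
  root system is connected, the same alternative holds for all roots, and the first one is
  impossible by rank.\<close>

lemma D_lattice_orth_cubic:
  assumes n: "1 < n" and \<phi>: "rep L (cong_lattice (n - 1) 1) \<phi>" and \<sigma>: "rep L (cong_lattice n 2) \<sigma>"
    and L: "\<not> represents L (cubic_lattice n)"
    and x: "x \<in> int_vecs (n - 1)" and y: "y \<in> lvecs (cong_lattice n 2)"
  shows "B (\<phi> x) (\<sigma> y) = 0"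
proof -
  have L': "\<not> represents L (cubic_lattice (Suc (n - 1)))" using L n by simp
  \<comment> \<open>For distinct \<open>i\<close>, \<open>j\<close> and \<open>\<epsilon>\<close>
    equal to 1 or -1, these and their negatives are the roots of \<open>D_lattice n\<close>.\<close>
  define \<rho> where "\<rho> i j \<epsilon> = unit_vec i + zmul \<epsilon> (unit_vec j)" for i j :: nat and \<epsilon> :: int
  have \<rho>: "\<rho> i j \<epsilon> \<in> lvecs (cong_lattice n 2)" if "i < n" "j < n" "\<bar>\<epsilon>\<bar> = 1" for i j \<epsilon>
    using that by (auto simp: \<rho>_def abs_if split: if_splits)
  have \<rho>_apply: "\<rho> i j \<epsilon> k = (if k = i then 1 else 0) + \<epsilon> * (if k = j then 1 else 0)" for i j k \<epsilon>
    by (simp add: \<rho>_def unit_vec_def)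
  have dot\<rho>: "dot n (\<rho> i j \<epsilon>) (\<rho> k l \<eta>) = \<rho> k l \<eta> i + \<epsilon> * \<rho> k l \<eta> j" if "i < n" "j < n" for i j k l \<epsilon> \<eta>
    using that by (simp add: \<rho>_def algebra_simps)
  define Im where "Im = \<phi> ` int_vecs (n - 1)"
  have Im_add: "a + b \<in> Im" "a - b \<in> Im" if "a \<in> Im" "b \<in> Im" for a b
  proof -
    obtain u v where uv: "u \<in> int_vecs (n - 1)" "v \<in> int_vecs (n - 1)" "a = \<phi> u" "b = \<phi> v"
      using \<open>a \<in> Im\<close> \<open>b \<in> Im\<close> by (auto simp: Im_def)
    then have "a + b = \<phi> (u + v)" "a - b = \<phi> (u - v)"
      using rep_linear(3,4)[OF \<phi>, of u v] by simp_all
    then show "a + b \<in> Im" "a - b \<in> Im" using uv unfolding Im_def by (metis imageI int_vecs_simps(2,3))+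
  qed
  have cases: "(\<forall>x\<in>int_vecs (n - 1). B (\<sigma> (\<rho> i j \<epsilon>)) (\<phi> x) = 0) \<or> \<sigma> (\<rho> i j \<epsilon>) \<in> Im"
    if ij: "i < n" "j < n" "i \<noteq> j" "\<bar>\<epsilon>\<bar> = 1" for i j \<epsilon>
  proof -
    have "\<epsilon> * \<epsilon> = 1" using ij by (simp add: abs_mult_self_eq[symmetric, of \<epsilon>])
    then have "B (\<sigma> (\<rho> i j \<epsilon>)) (\<sigma> (\<rho> i j \<epsilon>)) = 2"
      using rep_dot[OF \<sigma> \<rho> \<rho>, of i j \<epsilon> i j \<epsilon>] ij dot\<rho>[of i j \<epsilon> i j \<epsilon>] by (simp add: \<rho>_def unit_vec_def)
    then show ?thesis
      using root_cubic_cases[OF \<phi> L' rep_mem[OF \<sigma> \<rho>], of i j \<epsilon>] ij by (auto simp: Im_def)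
  qed
  have conn: "\<sigma> (\<rho> k l \<eta>) \<in> Im"
    if "\<sigma> (\<rho> i j \<epsilon>) \<in> Im" "i < n" "j < n" "i \<noteq> j" "\<bar>\<epsilon>\<bar> = 1" "k < n" "l < n" "k \<noteq> l" "\<bar>\<eta>\<bar> = 1"
      "\<rho> k l \<eta> i + \<epsilon> * \<rho> k l \<eta> j \<noteq> 0" for i j \<epsilon> k l \<eta>
  proof (rule ccontr)
    assume "\<not> ?thesis"
    then have "\<forall>x\<in>int_vecs (n - 1). B (\<sigma> (\<rho> k l \<eta>)) (\<phi> x) = 0"
      using cases[of k l \<eta>] that by blast
    then have "B (\<sigma> (\<rho> k l \<eta>)) (\<sigma> (\<rho> i j \<epsilon>)) = 0"
      using that(1) by (auto simp: Im_def)
    then have "dot n (\<rho> i j \<epsilon>) (\<rho> k l \<eta>) = 0"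
      using rep_dot[OF \<sigma> \<rho> \<rho>, of k l \<eta> i j \<epsilon>] that dot_commute by metis
    then show False using that dot\<rho> by metis
  qed
  have notIm: "\<sigma> (\<rho> i j \<epsilon>) \<notin> Im" if ij: "i < n" "j < n" "i \<noteq> j" "\<bar>\<epsilon>\<bar> = 1" for i j \<epsilon>
  proof
    assume im: "\<sigma> (\<rho> i j \<epsilon>) \<in> Im"
    have \<epsilon>0: "\<epsilon> \<noteq> 0" using ij by auto
    show False
    \<comment> \<open>The orthogonal roots e_0 + e_1 and e_0 - e_1 of \<open>D_lattice 2\<close> are
      not linked by \<open>conn\<close>, but in this case 2 would have to be a square.\<close>
    proof (cases "n = 2")
      case True
      obtain u where u: "u \<in> int_vecs 1" "\<sigma> (\<rho> i j \<epsilon>) = \<phi> u" using im True by (auto simp: Im_def)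
      have "\<epsilon> * \<epsilon> = 1" using ij by (simp add: abs_mult_self_eq[symmetric, of \<epsilon>])
      then have "B (\<phi> u) (\<phi> u) = 2"
        using rep_dot[OF \<sigma> \<rho> \<rho>, of i j \<epsilon> i j \<epsilon>] ij dot\<rho>[of i j \<epsilon> i j \<epsilon>]
        by (simp add: \<rho>_def unit_vec_def flip: u(2))
      then have "u 0 * u 0 = 2"
        using rep_dot[OF \<phi>, of u u] u(1) True by (simp add: dot_def)
      then have "\<bar>u 0\<bar> * \<bar>u 0\<bar> = 2" by (simp only: abs_mult_self_eq)
      moreover have "\<bar>u 0\<bar> = 0 \<or> \<bar>u 0\<bar> = 1 \<or> 2 \<le> \<bar>u 0\<bar>" by linarith
      moreover have "4 \<le> \<bar>u 0\<bar> * \<bar>u 0\<bar>" if "2 \<le> \<bar>u 0\<bar>"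
        using mult_mono[OF that that] by simp
      ultimately show False by (elim disjE) simp_all
    next
      case False
      \<comment> \<open>Each 2 e_k is a sum or difference of two roots not orthogonal to the given
        one. For \<open>k\<close> equal to \<open>i\<close> or \<open>j\<close> this takes a third
        index \<open>l\<close>, which exists as \<open>n\<close> exceeds 2.\<close>
      have two: "\<sigma> (zmul 2 (unit_vec k)) \<in> Im" if k: "k < n" for k
      proof -
        have d: "zmul 2 (unit_vec k) = \<rho> k l 1 + \<rho> k l (- 1)" for l
          by (simp add: \<rho>_def zmul_minus_left zmul_1 zmul_add_left[of 1 1, simplified])
        have d': "zmul 2 (unit_vec k) = \<rho> l k 1 - \<rho> l k (- 1)" for l
          by (simp add: \<rho>_def zmul_minus_left zmul_1 zmul_add_left[of 1 1, simplified])
        show ?thesis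
        proof (cases "k = i \<or> k = j")
          case False
          then have "\<sigma> (\<rho> i k 1) \<in> Im" "\<sigma> (\<rho> i k (- 1)) \<in> Im"
            by (rule_tac [!] conn[OF im ij]) (use k ij in \<open>auto simp: \<rho>_apply\<close>)
          then show ?thesis
            using Im_add(2) rep_linear(4)[OF \<sigma> \<rho> \<rho>, of i k 1 i k "- 1"] k ij
            unfolding d'[of i] by simp
        next
          case True
          have "card {i, j} < card {..<n}" using False n ij by simp
          then have "\<not> {..<n} \<subseteq> {i, j}" by (metis card_mono finite.emptyI finite_insert not_less)
          then obtain l where l: "l < n" "l \<noteq> i" "l \<noteq> j" by blast
          then have "\<sigma> (\<rho> k l 1) \<in> Im" "\<sigma> (\<rho> k l (- 1)) \<in> Im"
            by (rule_tac [!] conn[OF im ij]) (use k ij True \<epsilon>0 in \<open>auto simp: \<rho>_apply\<close>)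
          then show ?thesis
            using Im_add(1) rep_linear(3)[OF \<sigma> \<rho> \<rho>, of k l 1 k l "- 1"] k l
            unfolding d[of l] by simp
        qed
      qed
      define X where "X = (\<lambda>j. \<phi> (unit_vec j)) ` {..<n - 1}"
      have pm: "unit_vec j \<in> lvecs (cong_lattice (n - 1) 1)" if "j < n - 1" for j
        using that by simp
      have X: "finite X" "X \<subseteq> V" "card X \<le> n - 1"
        using rep_mem[OF \<phi> pm] card_image_le[of "{..<n - 1}" "\<lambda>j. \<phi> (unit_vec j)"] by (auto simp: X_def)
      have Im_span: "Im \<subseteq> zmod.span X"
      proof
        fix a assume "a \<in> Im"
        then obtain u where u: "u \<in> int_vecs (n - 1)" "a = \<phi> u" by (auto simp: Im_def)
        note add = rep_additive[OF \<phi> subspace_cong_lattice]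
        have "a = \<phi> (\<Sum>i<n - 1. zmul (u i) (unit_vec i))"
          using int_vecs_decomp[OF u(1)] u(2) by simp
        also have "\<dots> = (\<Sum>i<n - 1. \<phi> (zmul (u i) (unit_vec i)))"
          by (rule additive_on_sum[OF add]) auto
        also have "\<dots> = (\<Sum>i<n - 1. zmul (u i) (\<phi> (unit_vec i)))"
          by (intro sum.cong refl additive_on_zmul[OF add]) auto
        also have "\<dots> \<in> zmod.span X"
          by (intro zmod.span_sum zmod.span_scale zmod.span_base) (auto simp: X_def)
        finally show "a \<in> zmod.span X" .
      qed
      have dm: "zmul 2 (unit_vec k) \<in> lvecs (cong_lattice n 2)" if "k < n" for k
        using that by simp
      \<comment> \<open>The images of the \<open>n\<close> orthogonal vectors 2 e_k would lie in the
        span of at most \<open>n - 1\<close> vectors.\<close>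
      have "card {..<n} \<le> card X"
      proof (rule orthogonal_card_le[OF _ X(1,2)])
        show "\<sigma> (zmul 2 (unit_vec k)) \<in> zmod.span X" if "k \<in> {..<n}" for k
          using two[of k] that Im_span by auto
        show "B (\<sigma> (zmul 2 (unit_vec k))) (\<sigma> (zmul 2 (unit_vec l))) = 0"
          if "k \<in> {..<n}" "l \<in> {..<n}" "k \<noteq> l" for k l
          using that rep_dot[OF \<sigma> dm dm, of k l] by (simp, simp add: unit_vec_def)
        show "B (\<sigma> (zmul 2 (unit_vec k))) (\<sigma> (zmul 2 (unit_vec k))) \<noteq> 0"
          if "k \<in> {..<n}" for k
          using that rep_dot[OF \<sigma> dm dm, of k k] by (simp, simp add: unit_vec_def)
      qed simp
      then show False using X(3) n by simp
    qed
  qed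
  have px: "\<phi> x \<in> V" using rep_mem[OF \<phi>] x by simp
  have "B (\<phi> x) (\<sigma> (zmul 2 (unit_vec i))) = 0" if i: "i < n" for i
  proof -
    obtain j where j: "j < n" "j \<noteq> i" using n by (metis less_trans zero_less_one nat_neq_iff)
    have d: "zmul 2 (unit_vec i) = \<rho> i j 1 + \<rho> i j (- 1)"
      by (simp add: \<rho>_def zmul_minus_left zmul_1 zmul_add_left[of 1 1, simplified])
    have r0: "B (\<phi> x) (\<sigma> (\<rho> i j \<epsilon>)) = 0" "\<sigma> (\<rho> i j \<epsilon>) \<in> V" if "\<bar>\<epsilon>\<bar> = 1" for \<epsilon>
      using cases[of i j \<epsilon>] notIm[of i j \<epsilon>] that i j x sym[OF px rep_mem[OF \<sigma> \<rho>], of i j \<epsilon>]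
        rep_mem[OF \<sigma> \<rho>, of i j \<epsilon>] by auto
    show ?thesis
      using rep_linear(3)[OF \<sigma> \<rho> \<rho>, of i j 1 i j "- 1"] i j r0[of 1] r0[of "- 1"] px
      unfolding d by simp
  qed
  then show ?thesis by (rule orth_D_lattice[OF \<sigma> px _ y])
qed

end

subsection \<open>Lattices represented by an isolation\<close>

lemma lvecs_orth_sum [simp]: "lvecs (L \<bottom>\<^sub>L M) = lvecs L \<times> lvecs M"
  by (simp add: orth_sum_def)

lemma lform_orth_sum [simp]: "lform (L \<bottom>\<^sub>L M) (x, y) (x', y') = lform L x x' + lform M y y'"
  by (simp add: orth_sum_def)

lemma lvecs_orth_power: "lvecs (orth_power k L) = {f. (\<forall>i<k. f i \<in> lvecs L) \<and> (\<forall>i\<ge>k. f i = 0)}"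
  by (simp add: orth_power_def)

lemma lform_orth_power: "lform (orth_power k L) f g = (\<Sum>i<k. lform L (f i) (g i))"
  by (simp add: orth_power_def)

context pos_lattice
begin

lemma rep_orth_sum:
  assumes \<sigma>: "rep L M \<sigma>" and \<tau>: "rep L N \<tau>"
    and orth: "\<And>x y. x \<in> lvecs M \<Longrightarrow> y \<in> lvecs N \<Longrightarrow> B (\<sigma> x) (\<tau> y) = 0"
  shows "rep L (M \<bottom>\<^sub>L N) (\<lambda>z. \<sigma> (fst z) + \<tau> (snd z))"
  unfolding rep_def
proof (intro conjI ballI)
  fix z assume z: "z \<in> lvecs (M \<bottom>\<^sub>L N)"
  then have m: "fst z \<in> lvecs M" "snd z \<in> lvecs N" by auto
  note V = rep_mem[OF \<sigma> m(1)] rep_mem[OF \<tau> m(2)]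
  show "\<sigma> (fst z) + \<tau> (snd z) \<in> V" using V by simp
  have "lquad (M \<bottom>\<^sub>L N) z = lquad M (fst z) + lquad N (snd z)"
    by (cases z) (simp add: lquad_def)
  then show "lquad L (\<sigma> (fst z) + \<tau> (snd z)) = lquad (M \<bottom>\<^sub>L N) z"
    using \<sigma> \<tau> m V orth[OF m] sym[OF V] by (simp add: rep_def lquad_def)
next
  fix z w assume "z \<in> lvecs (M \<bottom>\<^sub>L N)" "w \<in> lvecs (M \<bottom>\<^sub>L N)"
  then show "\<sigma> (fst (z + w)) + \<tau> (snd (z + w)) = \<sigma> (fst z) + \<tau> (snd z) + (\<sigma> (fst w) + \<tau> (snd w))"
    using \<sigma> \<tau> by (auto simp: rep_def)
qed

lemma rep_orth_power:
  assumes \<sigma>: "\<And>i. i < k \<Longrightarrow> rep L M (\<sigma> i)"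
    and orth: "\<And>i j x y. i < k \<Longrightarrow> j < k \<Longrightarrow> i \<noteq> j \<Longrightarrow> x \<in> lvecs M \<Longrightarrow> y \<in> lvecs M \<Longrightarrow>
      B (\<sigma> i x) (\<sigma> j y) = 0"
  shows "rep L (orth_power k M) (\<lambda>f. \<Sum>i<k. \<sigma> i (f i))"
  unfolding rep_def
proof (intro conjI ballI)
  fix f assume f: "f \<in> lvecs (orth_power k M)"
  have m: "f i \<in> lvecs M" "\<sigma> i (f i) \<in> V" if "i < k" for i
    using f that rep_mem[OF \<sigma>[OF that]] by (auto simp: lvecs_orth_power)
  show V: "(\<Sum>i<k. \<sigma> i (f i)) \<in> V" using m(2) by (intro mem_sum) simp
  have "lquad L (\<Sum>i<k. \<sigma> i (f i)) = (\<Sum>i<k. B (\<sigma> i (f i)) (\<Sum>j<k. \<sigma> j (f j)))"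
    unfolding lquad_def using V m by (intro form_sum_left) auto
  also have "\<dots> = (\<Sum>i<k. lform M (f i) (f i))"
  proof (rule sum.cong[OF refl])
    fix i assume "i \<in> {..<k}"
    then have i: "i < k" by simp
    have "B (\<sigma> i (f i)) (\<Sum>j<k. \<sigma> j (f j)) = (\<Sum>j<k. B (\<sigma> i (f i)) (\<sigma> j (f j)))"
      using m i by (intro form_sum_right) auto
    also have "\<dots> = (\<Sum>j<k. if j = i then lform M (f i) (f i) else 0)"
      using m i orth \<sigma> by (intro sum.cong refl) (auto simp: rep_def lquad_def)
    also have "\<dots> = lform M (f i) (f i)" using i by simp
    finally show "B (\<sigma> i (f i)) (\<Sum>j<k. \<sigma> j (f j)) = lform M (f i) (f i)" .
  qed
  finally show "lquad L (\<Sum>i<k. \<sigma> i (f i)) = lquad (orth_power k M) f"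
    by (simp add: lquad_def lform_orth_power)
next
  fix f g assume "f \<in> lvecs (orth_power k M)" "g \<in> lvecs (orth_power k M)"
  then have "\<sigma> i ((f + g) i) = \<sigma> i (f i) + \<sigma> i (g i)" if "i < k" for i
    using \<sigma>[OF that] that by (auto simp: lvecs_orth_power rep_def)
  then show "(\<Sum>i<k. \<sigma> i ((f + g) i)) = (\<Sum>i<k. \<sigma> i (f i)) + (\<Sum>i<k. \<sigma> i (g i))"
    by (simp add: sum.distrib[symmetric])
qed

lemma root_lattice_orth_cubic:
  assumes \<phi>: "rep L (cong_lattice m 1) \<phi>" and \<sigma>: "rep L (cong_lattice n p) \<sigma>"
    and p: "prime p" "odd p" "2 * p\<^sup>2 < n" and L: "\<not> represents L (cubic_lattice n)"
    and x: "x \<in> int_vecs m" and y: "y \<in> lvecs (cong_lattice n 0)"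
  shows "B (\<phi> x) (\<sigma> y) = 0"
proof -
  have p3: "3 \<le> p" using p prime_gt_1_nat[of p] by (cases "p = 2") auto
  have "3 * p \<le> p * p" using p3 by (intro mult_right_mono) auto
  then have n: "16 < n" "2 * p < n" using p(3) p3 unfolding power2_eq_square by linarith+
  have y': "\<sigma> y \<in> V" using y by (intro rep_mem[OF \<sigma>]) simp
  have "B (\<sigma> y) (\<phi> (unit_vec i)) = 0" if i: "i < m" for i
  proof -
    have mem: "unit_vec i \<in> lvecs (cong_lattice m 1)" using i by simp
    have "B (\<phi> (unit_vec i)) (\<phi> (unit_vec i)) = 1"
      unfolding rep_dot[OF \<phi> mem mem] using i by (simp, simp add: unit_vec_def)
    then have "B (\<phi> (unit_vec i)) (\<sigma> y) = 0"
      using unit_norm_orth_roots[OF \<sigma> p(1) n L rep_mem[OF \<phi> mem] _ y] by blast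
    then show ?thesis using sym[OF y' rep_mem[OF \<phi> mem]] by simp
  qed
  then have "B (\<sigma> y) (\<phi> x) = 0" using orth_cubic[OF \<phi> y' x] by simp
  then show ?thesis using sym[OF y' rep_mem[OF \<phi>, of x]] x by simp
qed

text \<open>\<open>root_lattices_orth\<close> with \<open>q = 2\<close> handles e_i - e_k;
  precomposing \<open>\<tau>\<close> with a sign change handles e_i + e_k. Their sum 2 e_i suffices
  by \<open>orth_D_lattice\<close>.\<close>

lemma root_lattice_orth_D_lattice:
  assumes \<sigma>: "rep L (cong_lattice n p) \<sigma>" and \<tau>: "rep L (cong_lattice n 2) \<tau>"
    and p: "prime p" "odd p" "2 * p\<^sup>2 < n" and L: "\<not> represents L (cubic_lattice n)"
    and x: "x \<in> lvecs (cong_lattice n 0)" and y: "y \<in> lvecs (cong_lattice n 2)"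
  shows "B (\<sigma> x) (\<tau> y) = 0"
proof -
  have "2 < p" using p prime_gt_1_nat[of p] by (cases "p = 2") auto
  then have "2\<^sup>2 \<le> p\<^sup>2" by (intro power_mono) auto
  then have n: "2 * 2\<^sup>2 < n" "1 < n" using p(3) by auto
  have p2: "p \<noteq> 2" using p by auto
  have x': "\<sigma> x \<in> V" using x by (intro rep_mem[OF \<sigma>]) simp
  note orth = root_lattices_orth[OF \<sigma> _ p(1,2) two_is_prime_nat p2 p(3) n(1) L x]
  show ?thesis
  proof (rule orth_D_lattice[OF \<tau> x' _ y])
    fix i assume i: "i < n"
    obtain k where k: "k < n" "k \<noteq> i" using n by (metis less_trans zero_less_one nat_neq_iff)
    define a where "a = unit_vec i - unit_vec k"
    define b where "b = unit_vec i + unit_vec k"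
    have a: "a \<in> lvecs (cong_lattice n 0)" "a \<in> lvecs (cong_lattice n 2)"
      and b: "b \<in> lvecs (cong_lattice n 2)" using i k by (simp_all add: a_def b_def)
    have flip: "a - zmul (2 * a k) (unit_vec k) = b"
      using k by (auto simp: a_def b_def unit_vec_def fun_eq_iff)
    have "B (\<sigma> x) (\<tau> a) = 0" by (rule orth[OF \<tau> a(1)])
    moreover have "B (\<sigma> x) (\<tau> b) = 0"
      using orth[OF rep_comp[OF \<tau> rep_flip[OF k(1)]] a(1)] by (simp add: flip)
    moreover have "zmul 2 (unit_vec i) = a + b"
      by (auto simp: a_def b_def fun_eq_iff)
    ultimately show "B (\<sigma> x) (\<tau> (zmul 2 (unit_vec i))) = 0"
      using rep_linear(3)[OF \<tau> a(2) b] x' rep_mem[OF \<tau> a(2)] rep_mem[OF \<tau> b] by simp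
  qed
qed

end

section \<open>Assembling the orthogonal sum inside an isolation\<close>

lemma less_sqrt_half_iff: "real p < sqrt (real n / 2) \<longleftrightarrow> 2 * p\<^sup>2 < n"
proof -
  have "real p < sqrt (real n / 2) \<longleftrightarrow> (real p)\<^sup>2 < real n / 2"
    by (subst real_sqrt_less_iff[symmetric]) simp
  also have "\<dots> \<longleftrightarrow> real (2 * p\<^sup>2) < real n" by (simp add: field_simps)
  finally show ?thesis by (simp only: of_nat_less_iff)
qed

lemma finite_small_primes: "finite {p. prime p \<and> 2 * p\<^sup>2 < (n :: nat)}"
proof (rule finite_subset)
  show "{p. prime p \<and> 2 * p\<^sup>2 < n} \<subseteq> {..<n}"
  proof
    fix p assume "p \<in> {p. prime p \<and> 2 * p\<^sup>2 < n}"
    then have "2 * (p * p) < n" by (simp add: power2_eq_square)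
    moreover have "p \<le> p * p" by (rule le_square)
    ultimately have "p < n" by linarith
    then show "p \<in> {..<n}" by simp
  qed
qed simp

text \<open>The sublattices are proper: \<open>unit_vec 0\<close> has coordinate sum 1, which only
  the modulus 1 divides, and \<open>unit_vec (n - 1)\<close> is missing from the smaller cubic
  lattice.\<close>

lemma isolation_reps:
  assumes L: "isolation L (cubic_lattice n)" and n: "1 < n"
  shows "p \<noteq> 1 \<Longrightarrow> \<exists>\<sigma>. rep L (cong_lattice n p) \<sigma>" "\<exists>\<phi>. rep L (cong_lattice (n - 1) 1) \<phi>"
proof -
  have e0: "unit_vec 0 \<in> int_vecs n" "coord_sum n (unit_vec 0) = 1"
    "unit_vec (n - 1) \<in> int_vecs n" "unit_vec (n - 1) \<notin> int_vecs (n - 1)"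
    using n by (auto simp: int_vecs_def unit_vec_def coord_sum_def)
  have "represents L (cong_lattice n p)" if "p \<noteq> 1"
  proof -
    have "sublattice (cong_lattice n p) (cubic_lattice n)"
      using subspace_cong_lattice by (auto simp: sublattice_def cubic_lattice_def)
    moreover have "unit_vec 0 \<notin> lvecs (cong_lattice n p)"
      using e0 that by simp
    then have "lvecs (cong_lattice n p) \<noteq> lvecs (cubic_lattice n)"
      using e0(1) by (auto simp: cubic_lattice_def)
    ultimately show ?thesis using L by (simp add: isolation_def)
  qed
  then show "p \<noteq> 1 \<Longrightarrow> \<exists>\<sigma>. rep L (cong_lattice n p) \<sigma>" by (simp add: represents_iff)
  have dot: "dot (n - 1) x y = dot n x y" if "x \<in> int_vecs (n - 1)" for x y
  proof -
    have "dot n x y = (\<Sum>i<Suc (n - 1). x i * y i)" using n by (simp add: dot_def)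
    also have "\<dots> = dot (n - 1) x y" using that by (simp add: dot_def int_vecs_def)
    finally show ?thesis by simp
  qed
  have "sublattice (cong_lattice (n - 1) 1) (cubic_lattice n)"
    using subspace_cong_lattice dot by (auto simp: sublattice_def cubic_lattice_def int_vecs_def)
  moreover have "lvecs (cong_lattice (n - 1) 1) \<noteq> lvecs (cubic_lattice n)"
    using e0 by (auto simp: cubic_lattice_def)
  ultimately show "\<exists>\<phi>. rep L (cong_lattice (n - 1) 1) \<phi>"
    using L by (simp add: isolation_def represents_iff)
qed

lemma isolation_represents:
  fixes L :: "'b::ab_group_add zlat"
  assumes n: "1 < n" and L: "isolation L (cubic_lattice n)"
  shows "represents L (cubic_lattice (n - 1) \<bottom>\<^sub>L D_lattice n \<bottom>\<^sub>L
    orth_power (num_primes n - 1) (A_lattice (n - 1)))"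
proof -
  interpret pos_lattice L
    using L by unfold_locales (simp add: isolation_def)
  have nr: "\<not> represents L (cubic_lattice n)" using L by (simp add: isolation_def)
  define P where "P = {p. prime p \<and> 2 * p\<^sup>2 < n}"
  define k where "k = num_primes n - 1"
  have "num_primes n = card P"
    by (simp add: num_primes_def P_def less_sqrt_half_iff)
  \<comment> \<open>Setting 2 aside for \<open>D_lattice\<close> costs at most one prime. If no
    prime is small enough, truncated subtraction gives \<open>k = 0\<close>.\<close>
  then have "k \<le> card (P - {2})"
    using diff_card_le_card_Diff[of "{2}" P] by (simp add: k_def)
  moreover have "finite (P - {2})" using finite_small_primes by (simp add: P_def)
  ultimately obtain e where e: "inj_on e {..<k}" "e ` {..<k} \<subseteq> P - {2}"
    using card_le_inj[of "{..<k}" "P - {2}"] by auto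
  have ei: "prime (e i)" "odd (e i)" "2 * (e i)\<^sup>2 < n" "e i \<noteq> 1" if "i < k" for i
  proof -
    have "e i \<in> P - {2}" using that e(2) by auto
    then show "prime (e i)" "odd (e i)" "2 * (e i)\<^sup>2 < n" "e i \<noteq> 1"
      using primes_dvd_imp_eq[of 2 "e i"] by (auto simp: P_def)
  qed
  obtain \<phi> where \<phi>: "rep L (cong_lattice (n - 1) 1) \<phi>"
    using isolation_reps(2)[OF L n] by blast
  obtain \<tau> where \<tau>: "rep L (cong_lattice n 2) \<tau>"
    using isolation_reps(1)[OF L n, of 2] by auto
  have "\<exists>\<sigma>. \<forall>i. i < k \<longrightarrow> rep L (cong_lattice n (e i)) (\<sigma> i)"
    using isolation_reps(1)[OF L n ei(4)] by (intro choice) blast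
  then obtain \<sigma> where \<sigma>: "\<And>i. i < k \<Longrightarrow> rep L (cong_lattice n (e i)) (\<sigma> i)" by blast
  define S where "S f = (\<Sum>i<k. \<sigma> i (f i))" for f
  have A: "rep L (orth_power k (cong_lattice n 0)) S"
    unfolding S_def
  proof (rule rep_orth_power)
    show "rep L (cong_lattice n 0) (\<sigma> i)" if "i < k" for i
      using rep_cong_mono[OF \<sigma>[OF that], of 0] by simp
    show "B (\<sigma> i x) (\<sigma> j y) = 0"
      if "i < k" "j < k" "i \<noteq> j" "x \<in> lvecs (cong_lattice n 0)" "y \<in> lvecs (cong_lattice n 0)" for i j x y
      using root_lattices_orth[OF \<sigma>[OF that(1)] \<sigma>[OF that(2)] ei(1,2)[OF that(1)] ei(1)[OF that(2)]
          _ ei(3)[OF that(1)] ei(3)[OF that(2)] nr that(4,5)] e(1) that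
      by (auto simp: inj_on_def)
  qed
  have S_orth: "B z (S f) = 0"
    if z: "z \<in> V" and f: "f \<in> lvecs (orth_power k (cong_lattice n 0))"
      and orth: "\<And>i x. i < k \<Longrightarrow> x \<in> lvecs (cong_lattice n 0) \<Longrightarrow> B (\<sigma> i x) z = 0" for z f
  proof -
    have m: "f i \<in> lvecs (cong_lattice n 0)" if "i < k" for i
      using f that unfolding lvecs_orth_power by blast
    have V: "\<sigma> i (f i) \<in> V" if "i < k" for i
      using m[OF that] by (intro rep_mem[OF \<sigma>[OF that]]) simp
    have "B z (S f) = (\<Sum>i<k. B z (\<sigma> i (f i)))"
      unfolding S_def using z V by (intro form_sum_right) auto
    also have "\<dots> = 0"
      using orth[OF _ m] sym[OF z V] by (intro sum.neutral) auto
    finally show ?thesis .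
  qed
  have DA: "rep L (cong_lattice n 2 \<bottom>\<^sub>L orth_power k (cong_lattice n 0)) (\<lambda>z. \<tau> (fst z) + S (snd z))"
  proof (rule rep_orth_sum[OF \<tau> A])
    fix y f assume y: "y \<in> lvecs (cong_lattice n 2)" and f: "f \<in> lvecs (orth_power k (cong_lattice n 0))"
    show "B (\<tau> y) (S f) = 0"
      by (rule S_orth[OF rep_mem[OF \<tau> y] f])
        (rule root_lattice_orth_D_lattice[OF \<sigma> \<tau> ei(1-3) nr _ y])
  qed
  have "rep L (cong_lattice (n - 1) 1 \<bottom>\<^sub>L cong_lattice n 2 \<bottom>\<^sub>L orth_power k (cong_lattice n 0))
      (\<lambda>z. \<phi> (fst z) + (\<tau> (fst (snd z)) + S (snd (snd z))))"
  proof (rule rep_orth_sum[OF \<phi> DA])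
    fix x z assume x: "x \<in> lvecs (cong_lattice (n - 1) 1)"
      and z: "z \<in> lvecs (cong_lattice n 2 \<bottom>\<^sub>L orth_power k (cong_lattice n 0))"
    note px = rep_mem[OF \<phi> x]
    have x': "x \<in> int_vecs (n - 1)" using x by simp
    have z': "fst z \<in> lvecs (cong_lattice n 2)" "snd z \<in> lvecs (orth_power k (cong_lattice n 0))"
      using z by (auto simp del: mem_cong_lattice)
    have "B (\<phi> x) (S (snd z)) = 0"
      using sym[OF px] root_lattice_orth_cubic[OF \<phi> \<sigma> ei(1-3) nr x'] rep_mem[OF \<sigma>] px
      by (intro S_orth[OF px z'(2)]) auto
    moreover have "B (\<phi> x) (\<tau> (fst z)) = 0"
      by (rule D_lattice_orth_cubic[OF n \<phi> \<tau> nr x' z'(1)])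
    ultimately show "B (\<phi> x) (\<tau> (fst z) + S (snd z)) = 0"
      using px rep_mem[OF \<tau> z'(1)] rep_mem[OF A z'(2)] by simp
  qed
  then have "represents L (cong_lattice (n - 1) 1 \<bottom>\<^sub>L cong_lattice n 2 \<bottom>\<^sub>L
      orth_power k (cong_lattice n 0))"
    unfolding represents_iff by blast
  moreover have "0 < n" using n by simp
  ultimately show ?thesis
    by (simp only: cong_lattice_0 cong_lattice_1 cong_lattice_2 k_def)
qed

subsection \<open>The rank bound\<close>

lemma zform_left_0: "zform M \<Longrightarrow> y \<in> lvecs M \<Longrightarrow> lform M 0 y = 0"
  using additive_on_0[OF zform_additive] by blast

lemma zform_0_mem: "zform M \<Longrightarrow> 0 \<in> lvecs M"
  by (simp add: zform_def zmod.subspace_0)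

lemma zform_right_0: "zform M \<Longrightarrow> y \<in> lvecs M \<Longrightarrow> lform M y 0 = 0"
  using zform_left_0 zform_0_mem by (metis zform_def)

lemma zform_orth_sum:
  assumes M: "zform M" and N: "zform N"
  shows "zform (M \<bottom>\<^sub>L N)"
proof -
  have zmul_prod: "zmul k z = (zmul k (fst z), zmul k (snd z))" for k and z :: "'a \<times> 'b"
    by (induction k rule: int_induct[where k = 0]) (simp_all add: zmul_succ zmul_pred prod_eq_iff)
  have "zmod.subspace (lvecs M)" "zmod.subspace (lvecs N)" using M N by (simp_all add: zform_def)
  then have "zmod.subspace (lvecs M \<times> lvecs N)"
    by (intro zmod.subspaceI)
      (auto simp: zmul_prod zero_prod_def zmod.subspace_0 zmod.subspace_add zmod.subspace_scale)
  then show ?thesis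
    using M N by (auto simp: zform_def)
qed

text \<open>A certificate that the rank is at least \<open>k\<close>, additive under orthogonal sums
  and free of any choice of basis.\<close>

definition has_orth :: "'a::ab_group_add zlat \<Rightarrow> nat \<Rightarrow> bool" where
  "has_orth M k \<longleftrightarrow> (\<exists>S\<subseteq>lvecs M. finite S \<and> card S = k \<and> (\<forall>x\<in>S. 0 < lform M x x) \<and>
     (\<forall>x\<in>S. \<forall>y\<in>S. x \<noteq> y \<longrightarrow> lform M x y = 0))"

text \<open>Distinct indices give distinct vectors, because equal ones would be orthogonal and of
  positive norm at once.\<close>

lemma has_orthI:
  assumes I: "finite I" and v: "\<And>i. i \<in> I \<Longrightarrow> v i \<in> lvecs M"
    and pos: "\<And>i. i \<in> I \<Longrightarrow> 0 < lform M (v i) (v i)"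
    and orth: "\<And>i j. i \<in> I \<Longrightarrow> j \<in> I \<Longrightarrow> i \<noteq> j \<Longrightarrow> lform M (v i) (v j) = 0"
  shows "has_orth M (card I)"
proof -
  have "inj_on v I" using pos orth by (intro inj_onI) (metis less_irrefl)
  then show ?thesis
    unfolding has_orth_def using assms
    by (intro exI[of _ "v ` I"]) (auto simp: card_image)
qed

lemma has_orth_sum:
  assumes M: "zform M" "has_orth M k" and N: "zform N" "has_orth N l"
  shows "has_orth (M \<bottom>\<^sub>L N) (k + l)"
proof -
  obtain S where S: "S \<subseteq> lvecs M" "finite S" "card S = k" "\<And>x. x \<in> S \<Longrightarrow> 0 < lform M x x"
    "\<And>x y. x \<in> S \<Longrightarrow> y \<in> S \<Longrightarrow> x \<noteq> y \<Longrightarrow> lform M x y = 0"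
    using M(2) unfolding has_orth_def by blast
  obtain T where T: "T \<subseteq> lvecs N" "finite T" "card T = l" "\<And>x. x \<in> T \<Longrightarrow> 0 < lform N x x"
    "\<And>x y. x \<in> T \<Longrightarrow> y \<in> T \<Longrightarrow> x \<noteq> y \<Longrightarrow> lform N x y = 0"
    using N(2) unfolding has_orth_def by blast
  note zeros = zform_left_0[OF M(1)] zform_right_0[OF M(1)] zform_0_mem[OF M(1)]
    zform_left_0[OF N(1)] zform_right_0[OF N(1)] zform_0_mem[OF N(1)]
  have mem: "x \<in> S \<Longrightarrow> x \<in> lvecs M" "y \<in> T \<Longrightarrow> y \<in> lvecs N" for x y
    using S(1) T(1) by auto
  have "has_orth (M \<bottom>\<^sub>L N) (card (S <+> T))"
    by (rule has_orthI[where v = "case_sum (\<lambda>x. (x, 0)) (\<lambda>y. (0, y))"])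
      (use S(2,4,5) T(2,4,5) zeros mem in \<open>fastforce+\<close>)
  then show ?thesis using S T by (simp add: card_Plus)
qed

lemma has_orth_power:
  assumes M: "zform M" "has_orth M l"
  shows "has_orth (orth_power k M) (k * l)"
proof -
  obtain S where S: "S \<subseteq> lvecs M" "finite S" "card S = l" "\<And>x. x \<in> S \<Longrightarrow> 0 < lform M x x"
    "\<And>x y. x \<in> S \<Longrightarrow> y \<in> S \<Longrightarrow> x \<noteq> y \<Longrightarrow> lform M x y = 0"
    using M(2) unfolding has_orth_def by blast
  have mem: "x \<in> S \<Longrightarrow> x \<in> lvecs M" for x using S(1) by auto
  note zeros = zform_left_0[OF M(1)] zform_right_0[OF M(1)] zform_0_mem[OF M(1)]
  define v :: "nat \<times> 'a \<Rightarrow> nat \<Rightarrow> 'a" where "v = (\<lambda>(i, x) j. if j = i then x else 0)"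
  have form: "lform (orth_power k M) (v (i, x)) (v (j, y)) = (if i = j then lform M x y else 0)"
    if "i < k" "j < k" "x \<in> S" "y \<in> S" for i j x y
  proof -
    have "lform (orth_power k M) (v (i, x)) (v (j, y)) = 
        (\<Sum>a<k. if a = i then if i = j then lform M x y else 0 else 0)"
      unfolding lform_orth_power v_def
      using that mem zeros by (intro sum.cong) auto
    then show ?thesis using that by simp
  qed
  have "has_orth (orth_power k M) (card ({..<k} \<times> S))"
  proof (rule has_orthI[where v = v])
    show "v i \<in> lvecs (orth_power k M)" if "i \<in> {..<k} \<times> S" for i
      using that mem zeros by (auto simp: v_def lvecs_orth_power)
    show "0 < lform (orth_power k M) (v i) (v i)" if "i \<in> {..<k} \<times> S" for i
      using that form S(4) by auto
    show "lform (orth_power k M) (v i) (v j) = 0"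
      if "i \<in> {..<k} \<times> S" "j \<in> {..<k} \<times> S" "i \<noteq> j" for i j
      using that form S(5) by (cases i, cases j) (auto split: if_splits)
  qed (use S in simp)
  then show ?thesis using S by (simp add: card_cartesian_product)
qed

lemma zform_orth_power:
  assumes M: "zform M"
  shows "zform (orth_power k M)"
proof -
  have M': "zmod.subspace (lvecs M)"
    and sym: "\<And>x y. x \<in> lvecs M \<Longrightarrow> y \<in> lvecs M \<Longrightarrow> lform M x y = lform M y x"
    and add: "\<And>x y z. x \<in> lvecs M \<Longrightarrow> y \<in> lvecs M \<Longrightarrow> z \<in> lvecs M \<Longrightarrow>
      lform M (x + y) z = lform M x z + lform M y z"
    using M by (simp_all add: zform_def)
  have zmul_fun': "zmul c f i = zmul c (f i)" for c and f :: "nat \<Rightarrow> 'a" and i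
    by (induction c rule: int_induct[where k = 0]) (simp_all add: zmul_succ zmul_pred)
  have "zmod.subspace (lvecs (orth_power k M))"
    using M' by (intro zmod.subspaceI)
      (auto simp: lvecs_orth_power zmul_fun' zmod.subspace_0 zmod.subspace_add zmod.subspace_scale)
  moreover have "lform (orth_power k M) f g = lform (orth_power k M) g f"
    if "f \<in> lvecs (orth_power k M)" "g \<in> lvecs (orth_power k M)" for f g
    using that unfolding lform_orth_power by (intro sum.cong refl sym) (auto simp: lvecs_orth_power)
  moreover have "lform (orth_power k M) (f + g) h =
      lform (orth_power k M) f h + lform (orth_power k M) g h"
    if "f \<in> lvecs (orth_power k M)" "g \<in> lvecs (orth_power k M)" "h \<in> lvecs (orth_power k M)" for f g h
  proof -
    have "lform M ((f + g) i) (h i) = lform M (f i) (h i) + lform M (g i) (h i)" if "i < k" for i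
      using \<open>f \<in> _\<close> \<open>g \<in> _\<close> \<open>h \<in> _\<close> that by (simp add: lvecs_orth_power add)
    then show ?thesis by (simp add: lform_orth_power sum.distrib)
  qed
  ultimately show ?thesis by (simp add: zform_def)
qed

lemma has_orth_cubic: "has_orth (cong_lattice n 1) n"
proof -
  have "has_orth (cong_lattice n 1) (card {..<n})"
    by (rule has_orthI[where v = unit_vec]) (auto simp: unit_vec_def[THEN fun_cong])
  then show ?thesis by simp
qed

lemma has_orth_D: "has_orth (cong_lattice n 2) n"
proof -
  have "has_orth (cong_lattice n 2) (card {..<n})"
    by (rule has_orthI[where v = "\<lambda>i. zmul 2 (unit_vec i)"]) (auto simp: unit_vec_def[THEN fun_cong])
  then show ?thesis by simp
qed

lemma has_orth_A: "has_orth (cong_lattice n 0) (n - 1)"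
proof -
  \<comment> \<open>The vectors (1, ..., 1, -k, 0, ..., 0) with \<open>k\<close> ones. For
    \<open>k < l\<close> the vector \<open>w l\<close> is constantly 1 on the support of
    \<open>w k\<close>, so their product is the coordinate sum of \<open>w k\<close>, which is
    0.\<close>
  define w :: "nat \<Rightarrow> nat \<Rightarrow> int"
    where "w k i = (if i < k then 1 else if i = k then - int k else 0)" for k i
  have sum: "coord_sum n (w k) = 0" if "k < n" for k
  proof -
    have "coord_sum n (w k) = (\<Sum>i<k. w k i) + (\<Sum>i\<in>{k..<n}. w k i)"
      using that by (simp add: coord_sum_def lessThan_atLeast0 sum.atLeastLessThan_concat)
    also have "(\<Sum>i\<in>{k..<n}. w k i) = (\<Sum>i\<in>{k..<n}. if i = k then - int k else 0)"
      by (intro sum.cong) (auto simp: w_def)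
    also have "\<dots> = - int k" using that by simp
    also have "(\<Sum>i<k. w k i) = int k" by (simp add: w_def)
    finally show ?thesis by simp
  qed
  have dot0: "dot n (w k) (w l) = 0" if "k < l" "l < n" for k l
  proof -
    have "dot n (w k) (w l) = coord_sum n (w k)"
      unfolding dot_def coord_sum_def using that by (intro sum.cong) (auto simp: w_def)
    then show ?thesis using sum that by simp
  qed
  have "has_orth (cong_lattice n 0) (card {1..<n})"
  proof (rule has_orthI[where v = w])
    show "w k \<in> lvecs (cong_lattice n 0)" if "k \<in> {1..<n}" for k
      using that sum by (auto simp: int_vecs_def w_def)
    show "lform (cong_lattice n 0) (w k) (w l) = 0" if "k \<in> {1..<n}" "l \<in> {1..<n}" "k \<noteq> l" for k l
      using that dot0[of k l] dot0[of l k] by (cases "k < l") (auto simp: dot_commute[of n "w k" "w l"])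
    show "0 < lform (cong_lattice n 0) (w k) (w k)" if k: "k \<in> {1..<n}" for k
    proof -
      have "\<not> (\<forall>i<n. w k i = 0)" using k by (auto simp: w_def intro!: exI[of _ 0])
      then have "dot n (w k) (w k) \<noteq> 0" by (simp only: dot_eq_0_iff not_False_eq_True)
      then show ?thesis using dot_nonneg[of n "w k"] by simp
    qed
  qed simp
  then show ?thesis by simp
qed

text \<open>A representation preserves products, so the certificate moves into \<open>L\<close>,
  where \<open>orthogonal_card_le\<close> compares it with the basis chosen in
  \<open>lrank\<close>.\<close>

lemma orth_le_lrank:
  assumes L: "zlattice L" and M: "zform M" "has_orth M k" and rep: "represents L M"
  shows "k \<le> lrank L"
proof -
  interpret pos_lattice L by unfold_locales (rule L)
  obtain \<sigma> where \<sigma>: "rep L M \<sigma>" using rep by (auto simp: represents_iff)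
  obtain S where S: "S \<subseteq> lvecs M" "finite S" "card S = k" "\<And>x. x \<in> S \<Longrightarrow> 0 < lform M x x"
    "\<And>x y. x \<in> S \<Longrightarrow> y \<in> S \<Longrightarrow> x \<noteq> y \<Longrightarrow> lform M x y = 0"
    using M(2) unfolding has_orth_def by blast
  define X where "X = (SOME X. zbasis L X)"
  have "\<exists>X. zbasis L X" using L by (simp add: zlattice_def)
  then have X: "zbasis L X" unfolding X_def by (rule someI_ex)
  then have X': "finite X" "zmod.span X = V" by (simp_all add: zbasis_def)
  then have "X \<subseteq> V" using zmod.span_superset by blast
  have form: "B (\<sigma> x) (\<sigma> y) = lform M x y" if "x \<in> S" "y \<in> S" for x y
    using rep_form[OF zform M(1) \<sigma>] S(1) that by blast
  have "card S \<le> card X"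
  proof (rule orthogonal_card_le[OF S(2) X'(1) \<open>X \<subseteq> V\<close>, where v = \<sigma>])
    show "\<sigma> x \<in> zmod.span X" if "x \<in> S" for x
      using rep_mem[OF \<sigma>] S(1) that X'(2) by blast
    show "B (\<sigma> x) (\<sigma> y) = 0" if "x \<in> S" "y \<in> S" "x \<noteq> y" for x y
      using form that S(5) by simp
    show "B (\<sigma> x) (\<sigma> x) \<noteq> 0" if "x \<in> S" for x
      using form[OF that that] S(4)[OF that] by simp
  qed
  then show ?thesis using S(3) by (simp add: lrank_def X_def)
qed

lemma Iso_ge:
  assumes n: "1 < n"
  shows "enat ((n - 1) + (n + (num_primes n - 1) * (n - 1))) \<le> Iso (cubic_lattice n)"
  unfolding Iso_def
proof (rule INF_greatest)
  fix L :: "(nat \<Rightarrow> int) zlat" assume "L \<in> {L. isolation L (cubic_lattice n)}"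
  then have L: "isolation L (cubic_lattice n)" by simp
  have "represents L (cong_lattice (n - 1) 1 \<bottom>\<^sub>L cong_lattice n 2 \<bottom>\<^sub>L
      orth_power (num_primes n - 1) (cong_lattice n 0))"
    using isolation_represents[OF n L] cong_lattice_0[of n] n by (simp only: cong_lattice_1 cong_lattice_2)
  then have "(n - 1) + (n + (num_primes n - 1) * (n - 1)) \<le> lrank L"
  proof (rule orth_le_lrank[rotated 3])
    show "zlattice L" using L by (simp add: isolation_def)
    show "has_orth (cong_lattice (n - 1) 1 \<bottom>\<^sub>L cong_lattice n 2 \<bottom>\<^sub>L
        orth_power (num_primes n - 1) (cong_lattice n 0))
        ((n - 1) + (n + (num_primes n - 1) * (n - 1)))"
      by (intro has_orth_sum has_orth_power has_orth_cubic has_orth_D has_orth_A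
          zform_orth_sum zform_orth_power zform_cong_lattice)
  qed (intro zform_orth_sum zform_orth_power zform_cong_lattice)
  then show "enat ((n - 1) + (n + (num_primes n - 1) * (n - 1))) \<le> enat (lrank L)" by simp
qed

text \<open>For \<open>num_primes n = 0\<close> the real factor is -1 where truncated subtraction
  gives 0, so the real bound is the weaker one; otherwise both agree.\<close>

lemma Iso_ge_real:
  assumes n: "1 < n"
  shows "ereal (2 * real n - 1 + (real n - 1) * (real (num_primes n) - 1))
    \<le> ereal_of_enat (Iso (cubic_lattice n))"
proof -
  have "2 * real n - 1 + (real n - 1) * (real (num_primes n) - 1)
      \<le> real ((n - 1) + (n + (num_primes n - 1) * (n - 1)))"
  proof (cases "num_primes n")
    case (Suc t)
    then have "real ((n - 1) + (n + (num_primes n - 1) * (n - 1))) =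
        (real n - 1) + (real n + real t * (real n - 1))"
      using n by (simp add: of_nat_diff)
    then show ?thesis using Suc by (simp add: algebra_simps)
  qed (use n in \<open>simp add: of_nat_diff\<close>)
  then have "ereal (2 * real n - 1 + (real n - 1) * (real (num_primes n) - 1))
      \<le> ereal_of_enat (enat ((n - 1) + (n + (num_primes n - 1) * (n - 1))))" by simp
  also have "\<dots> \<le> ereal_of_enat (Iso (cubic_lattice n))"
    using Iso_ge[OF n] by (simp only: ereal_of_enat_le_iff)
  finally show ?thesis .
qed

subsection \<open>The number of small primes\<close>

text \<open>By the recursion \<open>1 / ((k + 1) C(N, k + 1)) = 1 / (k C(N - 1, k)) - 1 / (k C(N, k))\<close> of the
  harmonic triangle.\<close>

lemma binomial_dvd_common_multiple:
  fixes M N k :: nat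
  assumes "\<And>d. 1 \<le> d \<Longrightarrow> d \<le> N \<Longrightarrow> d dvd M" "1 \<le> k" "k \<le> N"
  shows "k * (N choose k) dvd M"
  using assms(2,3,1)
proof (induction k arbitrary: N rule: dec_induct)
  case base
  then show ?case by simp
next
  case (step k)
  have kN: "k \<le> N - 1" "k \<le> N" using step.prems(1) by linarith+
  have "k * ((N - 1) choose k) dvd M" "k * (N choose k) dvd M"
    using step.prems(2) by (intro step.IH kN; simp)+
  then obtain a where a: "M = k * ((N - 1) choose k) * a" by (elim dvdE)
  obtain b where b: "M = k * (N choose k) * b"
    using \<open>k * (N choose k) dvd M\<close> by (elim dvdE)
  define X where "X = Suc k * (N choose Suc k)"
  \<comment> \<open>The two absorption identities give N M = k X a and (N - k) M = k X b;
    subtracting yields M = X (a - b), in the integers to avoid truncation.\<close>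
  have X: "X = N * ((N - 1) choose k)" "X = (N - k) * (N choose k)"
    by (simp_all only: X_def binomial_absorption binomial_absorb_comp)
  have "N * M = k * (X * a)" unfolding a X(1) by (simp only: ac_simps)
  then have Na: "int N * int M = int k * (int X * int a)" by (metis of_nat_mult)
  have "(N - k) * M = k * (X * b)" unfolding b X(2) by (simp only: ac_simps)
  then have Nb: "int (N - k) * int M = int k * (int X * int b)" by (metis of_nat_mult)
  have "int k = int N - int (N - k)" using kN by simp
  then have "int k * int M = int N * int M - int (N - k) * int M"
    by (metis left_diff_distrib)
  then have "int k * int M = int k * (int X * (int a - int b))"
    unfolding Na Nb by (simp add: algebra_simps)
  then have "int M = int X * (int a - int b)" using step.hyps by simp
  then have "int X dvd int M" by (rule dvdI)
  then have "X dvd M" by (simp only: int_dvd_int_iff)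
  then show ?case by (simp only: X_def)
qed

text \<open>Nair's form of Chebyshev's argument: \<open>M\<close> is the least common multiple of 1,
  ..., N. It is divisible by \<open>k * (N choose k)\<close>, and each of its prime powers is at
  most \<open>N\<close>.\<close>

lemma binomial_le_power_card_primes:
  fixes N k :: nat
  assumes k: "1 \<le> k" "k \<le> N"
  shows "k * (N choose k) \<le> N ^ card {p. prime p \<and> p \<le> N}"
proof -
  define P where "P = {p. prime p \<and> p \<le> N}"
  define e where "e p = (GREATEST i. p ^ i \<le> N)" for p :: nat
  define M where "M = (\<Prod>p\<in>P. p ^ e p)"
  have P: "finite P" by (simp add: P_def)
  have bound: "i \<le> N" if "prime p" "p ^ i \<le> N" for p i :: nat
  proof -
    have "i < 2 ^ i" by (rule less_exp)
    also have "\<dots> \<le> p ^ i" using prime_ge_2_nat[OF that(1)] by (intro power_mono) auto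
    finally show ?thesis using that(2) by simp
  qed
  have e: "p ^ e p \<le> N" "p ^ i \<le> N \<Longrightarrow> i \<le> e p" if p: "prime p" for p i :: nat
  proof -
    have "p ^ 0 \<le> N" using k by simp
    then show "p ^ e p \<le> N"
      unfolding e_def by (rule GreatestI_nat) (use bound[OF p] in auto)
    show "p ^ i \<le> N \<Longrightarrow> i \<le> e p"
      unfolding e_def by (rule Greatest_le_nat) (use bound[OF p] in auto)
  qed
  have "d dvd M" if d: "1 \<le> d" "d \<le> N" for d
  proof -
    have sub: "prime_factors d \<subseteq> P"
    proof
      fix p assume p: "p \<in> prime_factors d"
      then have "p dvd d" "prime p" by auto
      then have "p \<le> d" using d by (intro dvd_imp_le) auto
      then show "p \<in> P" using \<open>prime p\<close> d by (simp add: P_def)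
    qed
    have "p ^ multiplicity p d dvd p ^ e p" if "p \<in> prime_factors d" for p
    proof -
      have "p ^ multiplicity p d \<le> d" using d by (intro dvd_imp_le multiplicity_dvd) auto
      then have "multiplicity p d \<le> e p" using d that by (intro e(2)) auto
      then show ?thesis by (rule le_imp_power_dvd)
    qed
    then have "(\<Prod>p\<in>prime_factors d. p ^ multiplicity p d) dvd (\<Prod>p\<in>prime_factors d. p ^ e p)"
      by (rule prod_dvd_prod)
    moreover have "d = (\<Prod>p\<in>prime_factors d. p ^ multiplicity p d)"
      using d by (intro prime_factorization_nat) simp
    moreover have "(\<Prod>p\<in>prime_factors d. p ^ e p) dvd M"
      unfolding M_def by (rule prod_dvd_prod_subset[OF P sub])
    ultimately show ?thesis using dvd_trans by metis
  qed
  then have "k * (N choose k) dvd M" using k by (intro binomial_dvd_common_multiple) auto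
  moreover have "0 < M"
    unfolding M_def by (intro prod_pos) (auto simp: P_def prime_gt_0_nat)
  ultimately have "k * (N choose k) \<le> M" by (rule dvd_imp_le)
  also have "M \<le> (\<Prod>p\<in>P. N)"
    unfolding M_def using e(1) by (intro prod_mono) (auto simp: P_def)
  finally show ?thesis by (simp add: P_def)
qed

text \<open>The central binomial coefficient in \<open>binomial_le_power_card_primes\<close> bounds
  4^m / 2 by a power of \<open>n\<close> with exponent \<open>num_primes n\<close>; logarithms give
  the claim.\<close>

lemma num_primes_lower_bound:
  assumes n: "16 \<le> n"
  shows "(sqrt (real n) / 4 - 2) / ln (real n) \<le> real (num_primes n)"
proof -
  \<comment> \<open>This choice gives 16 m^2 <= n, so primes up to 2 m satisfy 2 p^2 <= 8 m^2 < n;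
    the hypothesis on \<open>n\<close> makes \<open>m\<close> at least 1.\<close>
  define m where "m = nat \<lfloor>sqrt (real n) / 4\<rfloor>"
  have "sqrt 16 \<le> sqrt (real n)" using n by (intro real_sqrt_le_mono) simp
  then have s4: "4 \<le> sqrt (real n)" by simp
  have m: "real m \<le> sqrt (real n) / 4" "sqrt (real n) / 4 - 1 < real m"
    using s4 unfolding m_def by linarith+
  have m1: "1 \<le> m" using s4 unfolding m_def by linarith
  have "(4 * real m)\<^sup>2 \<le> (sqrt (real n))\<^sup>2" using m by (intro power_mono) auto
  then have "real (16 * m\<^sup>2) \<le> real n" by (simp add: power_mult_distrib)
  then have m2: "16 * m\<^sup>2 \<le> n" by (simp only: of_nat_le_iff)
  have mm: "1 \<le> m\<^sup>2" "m \<le> m\<^sup>2" using m1 by (simp_all add: power2_eq_square)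
  have "{p. prime p \<and> p \<le> 2 * m} \<subseteq> {p. prime p \<and> real p < sqrt (real n / 2)}"
  proof
    fix p assume p: "p \<in> {p. prime p \<and> p \<le> 2 * m}"
    then have "p\<^sup>2 \<le> (2 * m)\<^sup>2" by (intro power_mono) auto
    then have "2 * p\<^sup>2 < n" using m2 mm by (simp add: power_mult_distrib)
    then show "p \<in> {p. prime p \<and> real p < sqrt (real n / 2)}"
      using p by (simp add: less_sqrt_half_iff)
  qed
  moreover have "finite {p. prime p \<and> real p < sqrt (real n / 2)}"
    unfolding less_sqrt_half_iff by (rule finite_small_primes)
  ultimately have card: "card {p. prime p \<and> p \<le> 2 * m} \<le> num_primes n"
    unfolding num_primes_def by (intro card_mono)
  have le_n: "2 * m \<le> n" using m2 mm by linarith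
  have "real m * (4 ^ m / (2 * real m)) \<le> real m * real ((2 * m) choose m)"
    using central_binomial_lower_bound[of m] m1 by (intro mult_left_mono) auto
  then have "4 ^ m / 2 \<le> real (m * ((2 * m) choose m))" using m1 by simp
  also have "m * ((2 * m) choose m) \<le> (2 * m) ^ card {p. prime p \<and> p \<le> 2 * m}"
    using m1 by (intro binomial_le_power_card_primes) auto
  also have "\<dots> \<le> n ^ card {p. prime p \<and> p \<le> 2 * m}"
    using le_n by (intro power_mono) auto
  also have "\<dots> \<le> n ^ num_primes n"
    using card n by (intro power_increasing) auto
  finally have "4 ^ m / 2 \<le> real n ^ num_primes n" by simp
  moreover have "exp (real m - 1) \<le> 4 ^ m / (2 :: real)"
  proof -
    have "exp 1 \<le> (4 :: real)" using exp_le by simp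
    then have "exp 1 ^ m \<le> (4 :: real) ^ m" by (intro power_mono) auto
    moreover have "(2 :: real) \<le> exp 1" using exp_ge_add_one_self[of 1] by simp
    ultimately have "exp 1 ^ m / exp 1 \<le> (4 :: real) ^ m / 2" by (intro frac_le) auto
    then show ?thesis by (simp add: exp_diff exp_of_nat_mult[symmetric])
  qed
  ultimately have "exp (real m - 1) \<le> real n ^ num_primes n" by linarith
  then have "ln (exp (real m - 1)) \<le> ln (real n ^ num_primes n)"
    by (subst ln_le_cancel_iff) (use n in auto)
  then have "real m - 1 \<le> real (num_primes n) * ln (real n)"
    using n by (simp add: ln_realpow)
  \<comment> \<open>One unit is lost by rounding in \<open>m\<close>, the other by passing from 4^m
    / 2 to \<open>exp (real m - 1)\<close>; hence the constant 2.\<close>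
  then have "sqrt (real n) / 4 - 2 \<le> real (num_primes n) * ln (real n)" using m(2) by linarith
  moreover have "0 < ln (real n)" using n by simp
  ultimately show ?thesis by (simp add: pos_divide_le_eq)
qed

text \<open>The right-hand side has order n^(3/2) / ln n, and n^\<epsilon> outgrows ln n.\<close>

lemma eventually_powr_le:
  fixes \<epsilon> :: real
  assumes "0 < \<epsilon>"
  shows "\<forall>\<^sub>F n in sequentially.
    real n powr (3 / 2 - \<epsilon>) \<le> (real n - 1) * ((sqrt (real n) / 4 - 2) / ln (real n))"
  using assms by real_asymp

theorem theorem4p7:
  shows "(\<forall>n>1. \<forall>L :: 'a::ab_group_add zlat. isolation L (cubic_lattice n) \<longrightarrow>
            represents L (cubic_lattice (n - 1) \<bottom>\<^sub>L D_lattice n \<bottom>\<^sub>L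
              orth_power (num_primes n - 1) (A_lattice (n - 1))))
       \<and> (\<forall>n>1. ereal (2 * real n - 1 + (real n - 1) * (real (num_primes n) - 1))
            \<le> ereal_of_enat (Iso (cubic_lattice n)))
       \<and> (\<forall>\<epsilon>::real. \<epsilon> > 0 \<longrightarrow>
            in_Omega (\<lambda>n. Iso (cubic_lattice n)) (\<lambda>n. real n powr (3 / 2 - \<epsilon>)))"
proof (intro conjI allI impI)
  fix n :: nat and L :: "'a zlat"
  assume "1 < n" "isolation L (cubic_lattice n)"
  then show "represents L (cubic_lattice (n - 1) \<bottom>\<^sub>L D_lattice n \<bottom>\<^sub>L
      orth_power (num_primes n - 1) (A_lattice (n - 1)))"
    by (rule isolation_represents)
next
  fix n :: nat assume "1 < n"
  then show "ereal (2 * real n - 1 + (real n - 1) * (real (num_primes n) - 1))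
      \<le> ereal_of_enat (Iso (cubic_lattice n))"
    by (rule Iso_ge_real)
next
  fix \<epsilon> :: real assume "\<epsilon> > 0"
  from eventually_powr_le[OF this] eventually_ge_at_top[of 16]
  have "\<forall>\<^sub>F n in sequentially. ereal (1 * real n powr (3 / 2 - \<epsilon>)) \<le> ereal_of_enat (Iso (cubic_lattice n))"
  proof eventually_elim
    case (elim n)
    have "real n powr (3 / 2 - \<epsilon>) \<le> (real n - 1) * ((sqrt (real n) / 4 - 2) / ln (real n))"
      by (rule elim(1))
    also have "\<dots> \<le> (real n - 1) * real (num_primes n)"
      using elim(2) by (intro mult_left_mono num_primes_lower_bound) auto
    \<comment> \<open>Since n - 1 <= 2 n - 1, the linear term makes up for the 1 subtracted from
      \<open>num_primes n\<close>.\<close>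
    also have "\<dots> \<le> 2 * real n - 1 + (real n - 1) * (real (num_primes n) - 1)"
      by (simp add: algebra_simps)
    finally have "ereal (1 * real n powr (3 / 2 - \<epsilon>)) \<le>
        ereal (2 * real n - 1 + (real n - 1) * (real (num_primes n) - 1))" by simp
    also have "\<dots> \<le> ereal_of_enat (Iso (cubic_lattice n))"
      using elim(2) by (intro Iso_ge_real) simp
    finally show ?case .
  qed
  then show "in_Omega (\<lambda>n. Iso (cubic_lattice n)) (\<lambda>n. real n powr (3 / 2 - \<epsilon>))"
    unfolding in_Omega_def by (intro exI[of _ 1]) simp
qed

end
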